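(* Let $\kappa>0$, $K_*>0$, $T_*>0$ and let $V:\mathbf{R}\to\mathbf{R}$ be smooth with $V(0)=V'(0)=0$ and $V''(0)=:k>0$. Then there exist $\rho_*=\rho_*(V)>0$ (depending only on $V$), $\mu_*=\mu_*(K_*,T_*,\kappa,V)>0$ and $C_*=C_*(K_*,T_*,\kappa,V)>0$ for which the following holds when $\mu\in(0,\mu_*]$. Suppose that $(\tilde R,\tilde P)$ solves the FPUT system $$\dot{\tilde R}=\delta^+\tilde P,\qquad \dot{\tilde P}=\frac{1}{1+\mu}\,\delta^-[V'(\tilde R)]$$ with $$\|\tilde R(0)\|+\|\tilde P(0)\|\le\rho_*,$$ and that $(\tilde r,\tilde p)$ solves the driven simple harmonic oscillator $$\dot{\tilde r}=\tilde p-\tilde P,\qquad \mu\dot{\tilde p}=-\kappa\tilde r$$ subject to $$\left\|\tilde r(0)+\frac{\mu}{\kappa}\,\delta^-[V'(\tilde R(0))]\right\|+\sqrt{\mu}\left\|\tilde p(0)-\tilde P(0)+\frac{\mu}{\kappa}\,\delta^-[V''(\tilde R(0))\,\delta^+\tilde P(0)]\right\|\le K_*\mu^2.$$ Furthermore suppose that $(R,P,r,p)$ solves the mass-in-mass lattice $$\dot R=\delta^+P,\qquad \dot P=\delta^-[V'(R)]+\kappa r,\qquad \dot r=p-P,\qquad \mu\dot p=-\kappa r$$ with $$\|(R(0),P(0),r(0),p(0))-(\tilde R(0),\tilde P(0),\tilde r(0),\tilde p(0))\|_\mu\le K_*\mu^2.$$ Then $$\|(R(t),P(t),r(t),p(t))-(\tilde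 R(t),\tilde P(t),\tilde r(t),\tilde p(t))\|_\mu\le C_*\mu^2$$ for all $t\in[-T_*,T_*]$.
   Context: "Smooth" means $C^\infty$. All unknowns are functions of time $t$ with values in real sequences indexed by $j\in\mathbf{Z}$; the lattice index is suppressed. $\ell^2=\ell^2(\mathbf{Z})$ and $\|\cdot\|:=\|\cdot\|_{\ell^2}$. The mass-in-mass system is viewed as an ODE on the Hilbert space $(\ell^2)^4$, and the FPUT system and the oscillator system as ODEs on $(\ell^2)^2$; initial data and solutions are in these spaces. For a sequence $q$, $(\delta^{\pm}q)_j:=\pm(q_{j\pm1}-q_j)$; $V'(R)$ denotes the sequence with entries $V'(R_j)$, and similarly for $V''(R)$; products of sequences are taken entrywise. Dots are time derivatives. The norm $\|\cdot\|_\mu$ on $(\ell^2)^4$ is $$\|(R,P,r,p)\|_\mu:=\sqrt{\tfrac{k}{2}\|R\|^2+\tfrac12\|P\|^2+\tfrac{\kappa}{2}\|r\|^2+\tfrac{\mu}{2}\|p\|^2},$$ where $k=V''(0)$. *)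

theory Defs
  imports "HOL-Analysis.Analysis"
begin

section \<open>The Hilbert space of square-summable real sequences indexed by the integers\<close>

typedef l2 = "{x :: int \<Rightarrow> real. (\<lambda>j. (x j)\<^sup>2) summable_on UNIV}"
  morphisms entry l2_of_seq
  by (rule exI[of _ "\<lambda>_. 0"]) simp

setup_lifting type_definition_l2

lemma square_summable_entry: "(\<lambda>j. (entry x j)\<^sup>2) summable_on UNIV"
  using entry[of x] by simp

lemma entry_l2_of_seq:
  "(\<lambda>j. (x j)\<^sup>2) summable_on UNIV \<Longrightarrow> entry (l2_of_seq x) = x"
  by (simp add: l2_of_seq_inverse)

lemma l2_eqI: "(\<And>j. entry x j = entry y j) \<Longrightarrow> x = y"
  by (metis ext entry_inject)

lemma summable_on_mult_square:
  fixes x y :: "int \<Rightarrow> real"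
  assumes "(\<lambda>j. (x j)\<^sup>2) summable_on UNIV" "(\<lambda>j. (y j)\<^sup>2) summable_on UNIV"
  shows "(\<lambda>j. x j * y j) summable_on UNIV"
proof -
  have "(\<lambda>j. (x j)\<^sup>2 + (y j)\<^sup>2) summable_on UNIV"
    by (intro summable_on_add assms)
  moreover have "\<bar>x j * y j\<bar> \<le> (x j)\<^sup>2 + (y j)\<^sup>2" for j
  proof -
    have "2 * (\<bar>x j\<bar> * \<bar>y j\<bar>) \<le> (x j)\<^sup>2 + (y j)\<^sup>2"
      using sum_squares_bound[of "\<bar>x j\<bar>" "\<bar>y j\<bar>"] by simp
    then show ?thesis
      using mult_nonneg_nonneg[of "\<bar>x j\<bar>" "\<bar>y j\<bar>"] by (simp only: abs_mult) linarith
  qed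
  ultimately have "(\<lambda>j. \<bar>x j * y j\<bar>) summable_on UNIV"
    by (rule summable_on_comparison_test) auto
  then show ?thesis
    by (rule abs_summable_summable[of "\<lambda>j. x j * y j", simplified])
qed

lemma square_summable_add:
  fixes x y :: "int \<Rightarrow> real"
  assumes "(\<lambda>j. (x j)\<^sup>2) summable_on UNIV" "(\<lambda>j. (y j)\<^sup>2) summable_on UNIV"
  shows "(\<lambda>j. (x j + y j)\<^sup>2) summable_on UNIV"
proof -
  have "(\<lambda>j. (x j)\<^sup>2 + (y j)\<^sup>2 + 2 * (x j * y j)) summable_on UNIV"
    by (intro summable_on_add summable_on_cmult_right summable_on_mult_square assms)
  then show ?thesis
    by (simp add: power2_sum mult.assoc)
qed

lemma square_summable_cmult:
  fixes x :: "int \<Rightarrow> real"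
  assumes "(\<lambda>j. (x j)\<^sup>2) summable_on UNIV"
  shows "(\<lambda>j. (c * x j)\<^sup>2) summable_on UNIV"
  using assms by (simp add: power_mult_distrib summable_on_cmult_right)

lemma square_summable_diff:
  fixes x y :: "int \<Rightarrow> real"
  assumes "(\<lambda>j. (x j)\<^sup>2) summable_on UNIV" "(\<lambda>j. (y j)\<^sup>2) summable_on UNIV"
  shows "(\<lambda>j. (x j - y j)\<^sup>2) summable_on UNIV"
  using square_summable_add[OF assms(1) square_summable_cmult[OF assms(2), of "-1"]] by simp

lemma square_summable_shift:
  fixes x :: "int \<Rightarrow> real"
  assumes "(\<lambda>j. (x j)\<^sup>2) summable_on UNIV"
  shows "(\<lambda>j. (x (j + i))\<^sup>2) summable_on UNIV"
proof -
  have "bij_betw (\<lambda>j::int. j + i) UNIV UNIV"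
    by (rule bij_betwI[of _ _ _ "\<lambda>j. j - i"]) auto
  then show ?thesis
    using assms summable_on_reindex_bij_betw[of "\<lambda>j. j + i" UNIV UNIV "\<lambda>j. (x j)\<^sup>2"] by simp
qed

lemma square_summable_mult_bounded:
  fixes x a :: "int \<Rightarrow> real"
  assumes x: "(\<lambda>j. (x j)\<^sup>2) summable_on UNIV" and a: "\<And>j. \<bar>a j\<bar> \<le> B"
  shows "(\<lambda>j. (a j * x j)\<^sup>2) summable_on UNIV"
proof (rule summable_on_comparison_test)
  show "(\<lambda>j. (B * x j)\<^sup>2) summable_on UNIV"
    by (rule square_summable_cmult[OF x])
  have "\<bar>a j\<bar> \<le> \<bar>B\<bar>" for j
    using a[of j] by linarith
  then show "(a j * x j)\<^sup>2 \<le> (B * x j)\<^sup>2" for j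
    by (simp add: power_mult_distrib mult_right_mono abs_le_square_iff)
qed auto

instantiation l2 :: real_vector
begin

lift_definition zero_l2 :: l2 is "\<lambda>_. 0" by simp

lift_definition plus_l2 :: "l2 \<Rightarrow> l2 \<Rightarrow> l2" is "\<lambda>x y j. x j + y j"
  by (rule square_summable_add)

lift_definition minus_l2 :: "l2 \<Rightarrow> l2 \<Rightarrow> l2" is "\<lambda>x y j. x j - y j"
  by (rule square_summable_diff)

lift_definition uminus_l2 :: "l2 \<Rightarrow> l2" is "\<lambda>x j. - x j" by simp

lift_definition scaleR_l2 :: "real \<Rightarrow> l2 \<Rightarrow> l2" is "\<lambda>c x j. c * x j"
  by (rule square_summable_cmult)

instance
proof
  fix x y z :: l2 and c d :: real
  show "x + y + z = x + (y + z)" "x + y = y + x" "0 + x = x" "- x + x = 0" "x - y = x + - y"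
    by (transfer, simp add: algebra_simps)+
  show "c *\<^sub>R (x + y) = c *\<^sub>R x + c *\<^sub>R y" "(c + d) *\<^sub>R x = c *\<^sub>R x + d *\<^sub>R x"
    "c *\<^sub>R d *\<^sub>R x = (c * d) *\<^sub>R x" "1 *\<^sub>R x = x"
    by (transfer, simp add: algebra_simps)+
qed

end

instantiation l2 :: real_inner
begin

definition inner_l2 :: "l2 \<Rightarrow> l2 \<Rightarrow> real"
  where "inner_l2 x y = (\<Sum>\<^sub>\<infinity>j. entry x j * entry y j)"

definition norm_l2 :: "l2 \<Rightarrow> real"
  where "norm_l2 x = sqrt (\<Sum>\<^sub>\<infinity>j. (entry x j)\<^sup>2)"

definition dist_l2 :: "l2 \<Rightarrow> l2 \<Rightarrow> real"
  where "dist_l2 x y = norm (x - y)"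

definition sgn_l2 :: "l2 \<Rightarrow> l2"
  where "sgn_l2 x = x /\<^sub>R norm x"

definition uniformity_l2 :: "(l2 \<times> l2) filter"
  where "uniformity_l2 = (INF e\<in>{0<..}. principal {(x, y). dist x y < e})"

definition open_l2 :: "l2 set \<Rightarrow> bool"
  where "open_l2 U \<longleftrightarrow> (\<forall>x\<in>U. eventually (\<lambda>(x', y). x' = x \<longrightarrow> y \<in> U) uniformity)"

instance
proof
  fix x y z :: l2 and c :: real
  show "dist x y = norm (x - y)" by (rule dist_l2_def)
  show "sgn x = x /\<^sub>R norm x" by (rule sgn_l2_def)
  show "uniformity = (INF e\<in>{0<..}. principal {(x, y). dist x y < (e::real)} :: (l2 \<times> l2) filter)"
    by (rule uniformity_l2_def)
  show "open U \<longleftrightarrow> (\<forall>x\<in>U. eventually (\<lambda>(x', y). x' = x \<longrightarrow> y \<in> U) uniformity)" for U :: "l2 set"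
    by (rule open_l2_def)
  have mult: "(\<lambda>j. entry u j * entry v j) summable_on UNIV" for u v
    by (intro summable_on_mult_square square_summable_entry)
  show "inner x y = inner y x"
    by (simp add: inner_l2_def mult.commute)
  show "inner (x + y) z = inner x z + inner y z"
    using infsum_add[OF mult[of x z] mult[of y z]]
    by (simp add: inner_l2_def plus_l2.rep_eq algebra_simps)
  show "inner (c *\<^sub>R x) y = c * inner x y"
    by (simp add: inner_l2_def scaleR_l2.rep_eq mult.assoc infsum_cmult_right')
  show "0 \<le> inner x x"
    by (simp add: inner_l2_def infsum_nonneg)
  show "norm x = sqrt (inner x x)"
    by (simp add: inner_l2_def norm_l2_def power2_eq_square)
  show "inner x x = 0 \<longleftrightarrow> x = 0"
  proof
    assume "inner x x = 0"
    then have "entry x j * entry x j = 0" for j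
      by (intro nonneg_infsum_le_0D[OF _ mult[of x x], of j]) (simp_all add: inner_l2_def)
    then show "x = 0"
      by (intro l2_eqI) (simp add: zero_l2.rep_eq)
  qed (simp add: inner_l2_def zero_l2.rep_eq)
qed

end


section \<open>Difference operators and entrywise nonlinearities\<close>

lift_definition delta_plus :: "l2 \<Rightarrow> l2" is "\<lambda>q j. q (j + 1) - q j"
  by (rule square_summable_diff[OF square_summable_shift])

lift_definition delta_minus :: "l2 \<Rightarrow> l2" is "\<lambda>q j. - (q (j - 1) - q j)"
proof -
  fix q :: "int \<Rightarrow> real" assume "(\<lambda>j. (q j)\<^sup>2) summable_on UNIV"
  then show "(\<lambda>j. (- (q (j - 1) - q j))\<^sup>2) summable_on UNIV"
    using square_summable_diff[OF square_summable_shift, of q q "-1"] by (simp del: minus_diff_eq)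
qed

text \<open>
  \<open>l2_of_seq\<close> is unspecified on sequences that are not square-summable.  The lemmas
  \<open>entry_map_entries\<close> and \<open>entry_weight_entries\<close> below show that this never happens
  for the nonlinearities \<open>f = V'\<close> and \<open>f = V''\<close> to which these two operations are applied.
\<close>

definition map_entries :: "(real \<Rightarrow> real) \<Rightarrow> l2 \<Rightarrow> l2"
  where "map_entries f x = l2_of_seq (\<lambda>j. f (entry x j))"

text \<open>For \<open>f 0 \<noteq> 0\<close> the sequence \<open>f(x)\<close> is not in the space, but its entrywise product with
  an element of the space is.\<close>

definition weight_entries :: "(real \<Rightarrow> real) \<Rightarrow> l2 \<Rightarrow> l2 \<Rightarrow> l2"
  where "weight_entries f x y = l2_of_seq (\<lambda>j. f (entry x j) * entry y j)"

definition smooth :: "(real \<Rightarrow> real) \<Rightarrow> bool"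
  where "smooth f \<longleftrightarrow> (\<forall>n x. (deriv ^^ n) f differentiable (at x))"

lemma abs_entry_le_norm: "\<bar>entry x j\<bar> \<le> norm x"
proof -
  have "(\<Sum>\<^sub>\<infinity>i\<in>{j}. (entry x i)\<^sup>2) \<le> (\<Sum>\<^sub>\<infinity>i. (entry x i)\<^sup>2)"
    by (rule infsum_mono2) (auto intro: square_summable_entry)
  then have "(entry x j)\<^sup>2 \<le> (\<Sum>\<^sub>\<infinity>i. (entry x i)\<^sup>2)"
    by simp
  then have "sqrt ((entry x j)\<^sup>2) \<le> norm x"
    unfolding norm_l2_def by (rule real_sqrt_le_mono)
  then show ?thesis by simp
qed

lemma bounded_on_entries:
  fixes f :: "real \<Rightarrow> real"
  assumes "continuous_on UNIV f"
  obtains B where "\<And>t. \<bar>t\<bar> \<le> norm (x :: l2) \<Longrightarrow> \<bar>f t\<bar> \<le> B"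
proof -
  have "compact (f ` {- norm x .. norm x})"
    using assms by (intro compact_continuous_image) (auto intro: continuous_on_subset)
  then obtain B where "\<forall>y \<in> f ` {- norm x .. norm x}. norm y \<le> B"
    using compact_imp_bounded bounded_iff by blast
  then have "\<bar>f t\<bar> \<le> B" if "\<bar>t\<bar> \<le> norm x" for t
    using that by (auto simp: abs_le_iff)
  then show ?thesis by (rule that)
qed

lemma entry_weight_entries:
  assumes "continuous_on UNIV f"
  shows "entry (weight_entries f x y) j = f (entry x j) * entry y j"
proof -
  obtain B where "\<And>t. \<bar>t\<bar> \<le> norm x \<Longrightarrow> \<bar>f t\<bar> \<le> B"
    using bounded_on_entries[OF assms] by blast
  then have "\<bar>f (entry x j)\<bar> \<le> B" for j
    using abs_entry_le_norm by blast
  then have "(\<lambda>j. (f (entry x j) * entry y j)\<^sup>2) summable_on UNIV"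
    by (rule square_summable_mult_bounded[OF square_summable_entry])
  then show ?thesis
    unfolding weight_entries_def by (subst entry_l2_of_seq) auto
qed

lemma entry_map_entries:
  assumes "\<And>t. (f has_real_derivative f' t) (at t)" "continuous_on UNIV f'" "f 0 = 0"
  shows "entry (map_entries f x) j = f (entry x j)"
proof -
  obtain B where B: "\<And>t. \<bar>t\<bar> \<le> norm x \<Longrightarrow> \<bar>f' t\<bar> \<le> B"
    using bounded_on_entries[OF assms(2)] by blast
  have lip: "\<bar>f t\<bar> \<le> B * \<bar>t\<bar>" if "\<bar>t\<bar> \<le> norm x" for t
  proof -
    have "norm (f t - f 0) \<le> B * norm (t - 0)"
    proof (rule field_differentiable_bound[of "{- norm x .. norm x}" f f'])
      show "(f has_field_derivative f' s) (at s within {- norm x .. norm x})" for s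
        using assms(1) has_field_derivative_at_within by blast
      show "norm (f' s) \<le> B" if "s \<in> {- norm x .. norm x}" for s
        using that by (auto intro!: B)
      show "t \<in> {- norm x .. norm x}" "0 \<in> {- norm x .. norm x}"
        using that by (auto simp: abs_le_iff)
    qed simp
    then show ?thesis using assms(3) by simp
  qed
  have "(\<lambda>j. (f (entry x j))\<^sup>2) summable_on UNIV"
  proof (rule summable_on_comparison_test)
    show "(\<lambda>j. (B * entry x j)\<^sup>2) summable_on UNIV"
      by (intro square_summable_cmult square_summable_entry)
    have "\<bar>f (entry x j)\<bar> \<le> \<bar>B * entry x j\<bar>" for j
      using lip[OF abs_entry_le_norm, of j] mult_right_mono[of B "\<bar>B\<bar>" "\<bar>entry x j\<bar>"]
      unfolding abs_mult by linarith
    then show "(f (entry x j))\<^sup>2 \<le> (B * entry x j)\<^sup>2" for j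
      by (simp only: abs_le_square_iff)
  qed auto
  then show ?thesis
    unfolding map_entries_def by (subst entry_l2_of_seq) auto
qed

lemma smooth_has_derivs:
  assumes "smooth V"
  shows "((deriv ^^ n) V has_real_derivative (deriv ^^ Suc n) V t) (at t)"
    and "continuous_on UNIV ((deriv ^^ n) V)"
proof -
  show *: "((deriv ^^ n) V has_real_derivative (deriv ^^ Suc n) V t) (at t)" for t
    using assms unfolding smooth_def
    by (metis DERIV_deriv_iff_real_differentiable comp_apply funpow.simps(2))
  then show "continuous_on UNIV ((deriv ^^ n) V)"
    by (meson DERIV_isCont continuous_at_imp_continuous_on)
qed

lemma entry_map_entries_deriv:
  assumes "smooth V" "deriv V 0 = 0"
  shows "entry (map_entries (deriv V) x) j = deriv V (entry x j)"
  using entry_map_entries[OF smooth_has_derivs(1)[OF assms(1), of 1]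
      smooth_has_derivs(2)[OF assms(1)]] assms(2) by simp

lemma entry_weight_entries_deriv2:
  assumes "smooth V"
  shows "entry (weight_entries (deriv (deriv V)) x y) j = deriv (deriv V) (entry x j) * entry y j"
  using entry_weight_entries[OF smooth_has_derivs(2)[OF assms, of 2]]
  by (simp add: numeral_2_eq_2)


section \<open>The lattice systems\<close>

text \<open>
  Time derivatives are taken in the norm of \<open>l2\<close>; at an endpoint of the time interval \<open>J\<close>
  they are one-sided.
\<close>

definition solves_FPUT ::
    "(real \<Rightarrow> real) \<Rightarrow> real \<Rightarrow> real set \<Rightarrow> (real \<Rightarrow> l2) \<Rightarrow> (real \<Rightarrow> l2) \<Rightarrow> bool"
  where "solves_FPUT V \<mu> J R P \<longleftrightarrow> (\<forall>t\<in>J.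
    (R has_vector_derivative delta_plus (P t)) (at t within J) \<and>
    (P has_vector_derivative (1 / (1 + \<mu>)) *\<^sub>R delta_minus (map_entries (deriv V) (R t)))
      (at t within J))"

definition solves_driven_oscillator ::
    "real \<Rightarrow> real \<Rightarrow> (real \<Rightarrow> l2) \<Rightarrow> real set \<Rightarrow> (real \<Rightarrow> l2) \<Rightarrow> (real \<Rightarrow> l2) \<Rightarrow> bool"
  where "solves_driven_oscillator \<kappa> \<mu> P J r p \<longleftrightarrow> (\<forall>t\<in>J.
    (r has_vector_derivative p t - P t) (at t within J) \<and>
    ((\<lambda>s. \<mu> *\<^sub>R p s) has_vector_derivative - (\<kappa> *\<^sub>R r t)) (at t within J))"

definition solves_mass_in_mass ::
    "(real \<Rightarrow> real) \<Rightarrow> real \<Rightarrow> real \<Rightarrow> real set \<Rightarrow>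
     (real \<Rightarrow> l2) \<Rightarrow> (real \<Rightarrow> l2) \<Rightarrow> (real \<Rightarrow> l2) \<Rightarrow> (real \<Rightarrow> l2) \<Rightarrow> bool"
  where "solves_mass_in_mass V \<kappa> \<mu> J R P r p \<longleftrightarrow> (\<forall>t\<in>J.
    (R has_vector_derivative delta_plus (P t)) (at t within J) \<and>
    (P has_vector_derivative delta_minus (map_entries (deriv V) (R t)) + \<kappa> *\<^sub>R r t)
      (at t within J) \<and>
    (r has_vector_derivative p t - P t) (at t within J) \<and>
    ((\<lambda>s. \<mu> *\<^sub>R p s) has_vector_derivative - (\<kappa> *\<^sub>R r t)) (at t within J))"

fun mu_norm :: "real \<Rightarrow> real \<Rightarrow> real \<Rightarrow> l2 \<times> l2 \<times> l2 \<times> l2 \<Rightarrow> real"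
  where "mu_norm k \<kappa> \<mu> (R, P, r, p) =
    sqrt (k / 2 * (norm R)\<^sup>2 + 1 / 2 * (norm P)\<^sup>2 + \<kappa> / 2 * (norm r)\<^sup>2 + \<mu> / 2 * (norm p)\<^sup>2)"

end

theory Submission
  imports Defs
begin

text \<open>
  Write primes for the approximating solution and let \<open>y = p' - P'\<close> be the relative momentum of
  the driven oscillator.  Because \<open>(1 + \<mu>) dP'/dt = \<delta>\<^sup>-V'(R')\<close> and
  \<open>\<mu> dp'/dt = - \<kappa> r'\<close>, the approximating solution satisfies the mass-in-mass equations up to the
  single residual \<open>- \<mu> dy/dt\<close> in the equation for the momentum.  The residual is in general not of size
  \<open>\<mu>\<^sup>2\<close>, since \<open>y\<close> may oscillate at the fast frequency \<open>sqrt (\<kappa> / \<mu>)\<close>, but it is a time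
  derivative.  Moving it into the unknown, that is, replacing the error \<open>P - P'\<close> by
  \<open>m = P - P' + \<mu> y\<close>, leaves the forcing terms \<open>\<mu> \<delta>\<^sup>+y\<close> and \<open>\<mu> y\<close>, which are \<open>O(\<mu>\<^sup>2)\<close>
  once \<open>y = O(\<mu>)\<close>.  An energy estimate and Gronwall's inequality then give the
  theorem (\<open>approximation_error\<close>).

  The bound \<open>y = O(\<mu>)\<close> comes from the slow manifold of the oscillator.  The deviations
  \<open>q = r' + (\<mu>/\<kappa>) dP'/dt\<close> and \<open>v = p' - P' + (\<mu>/\<kappa>) d\<^sup>2P'/dt\<^sup>2\<close> solve \<open>dq/dt = v\<close>,
  \<open>\<mu> dv/dt = - \<kappa> q + (\<mu>\<^sup>2/\<kappa>) d\<^sup>3P'/dt\<^sup>3\<close>, and the hypothesis on the initial data says that they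
  start small.  Their energy \<open>\<kappa>/2 \<parallel>q\<parallel>\<^sup>2 + \<mu>/2 \<parallel>v\<parallel>\<^sup>2\<close> therefore stays \<open>O(\<mu>\<^sup>3)\<close>, so that
  \<open>v = O(\<mu>)\<close> (\<open>driven_oscillator_follows_drive\<close>).  The third derivative of \<open>P'\<close> is bounded
  uniformly in \<open>\<mu>\<close> because it is an expression in the first three
  derivatives of \<open>V\<close> and in \<open>R'\<close>, \<open>P'\<close>
  (\<open>FPUT_third_derivative\<close>), and \<open>R'\<close>, \<open>P'\<close> stay small for all time: the origin is
  Lyapunov stable for the FPUT lattice, whose conserved energy is coercive near the origin
  because \<open>V''(0) > 0\<close> (\<open>FPUT_stability\<close>).  This is where \<open>\<rho>\<^sub>s\<close> comes from, and why it depends on \<open>V\<close>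
  only.

  Lipschitz bounds for \<open>V'\<close> require that \<open>R\<close> stays in a fixed ball as well.  As long
  as it lies in the unit ball, the error estimate keeps it within \<open>1/2\<close> of \<open>R'\<close>, which lies in
  the ball of radius \<open>1/2\<close>; so it can never reach the boundary (\<open>continuation_bound\<close>).
\<close>

section \<open>Calculus on square-summable sequences\<close>

lemmas entry_simps = zero_l2.rep_eq plus_l2.rep_eq minus_l2.rep_eq uminus_l2.rep_eq
  scaleR_l2.rep_eq delta_plus.rep_eq delta_minus.rep_eq

lemma norm_le_of_entries:
  assumes "\<And>j. \<bar>entry x j\<bar> \<le> C * \<bar>entry y j\<bar>" and "0 \<le> C"
  shows "norm x \<le> C * norm y"
proof -
  have "(\<Sum>\<^sub>\<infinity>j. (entry x j)\<^sup>2) \<le> (\<Sum>\<^sub>\<infinity>j. (C * entry y j)\<^sup>2)"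
  proof (rule infsum_mono)
    show "(\<lambda>j. (entry x j)\<^sup>2) summable_on UNIV" "(\<lambda>j. (C * entry y j)\<^sup>2) summable_on UNIV"
      by (auto intro: square_summable_entry square_summable_cmult)
    show "(entry x j)\<^sup>2 \<le> (C * entry y j)\<^sup>2" for j
      using assms by (simp add: abs_le_square_iff[symmetric] abs_mult)
  qed
  also have "\<dots> = C\<^sup>2 * (norm y)\<^sup>2"
    by (simp add: norm_l2_def power_mult_distrib infsum_cmult_right' infsum_nonneg)
  finally have "(norm x)\<^sup>2 \<le> (C * norm y)\<^sup>2"
    by (simp add: norm_l2_def infsum_nonneg power_mult_distrib)
  then show ?thesis
    using assms(2) by (simp add: power2_le_iff_abs_le)
qed

lemma norm_shift:
  assumes "\<And>j. entry y j = entry x (j + i)"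
  shows "norm y = norm x"
proof -
  have "bij_betw (\<lambda>j::int. j + i) UNIV UNIV"
    by (rule bij_betwI[of _ _ _ "\<lambda>j. j - i"]) auto
  from infsum_reindex_bij_betw[OF this, of "\<lambda>j. (entry x j)\<^sup>2"] show ?thesis
    by (simp add: norm_l2_def assms)
qed

definition shift :: "int \<Rightarrow> l2 \<Rightarrow> l2"
  where "shift i x = l2_of_seq (\<lambda>j. entry x (j + i))"

lemma entry_shift: "entry (shift i x) j = entry x (j + i)"
  by (simp add: shift_def entry_l2_of_seq square_summable_shift square_summable_entry)

lemma delta_plus_eq_shift: "delta_plus x = shift 1 x - x"
  by (rule l2_eqI) (simp add: entry_simps entry_shift)

lemma delta_minus_eq_shift: "delta_minus x = x - shift (-1) x"
  by (rule l2_eqI) (simp add: entry_simps entry_shift)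

lemma norm_delta_plus_le: "norm (delta_plus x) \<le> 2 * norm x"
  using norm_triangle_ineq4[of "shift 1 x" x] norm_shift[of "shift 1 x" x 1]
  by (simp add: delta_plus_eq_shift entry_shift)

lemma norm_delta_minus_le: "norm (delta_minus x) \<le> 2 * norm x"
  using norm_triangle_ineq4[of x "shift (-1) x"] norm_shift[of "shift (-1) x" x "-1"]
  by (simp add: delta_minus_eq_shift entry_shift)

lemma bounded_linear_delta_plus: "bounded_linear delta_plus"
  by (rule bounded_linear_intro[where K = 2])
    (use norm_delta_plus_le in \<open>auto intro!: l2_eqI simp: entry_simps algebra_simps\<close>)

lemma bounded_linear_delta_minus: "bounded_linear delta_minus"
  by (rule bounded_linear_intro[where K = 2])
    (use norm_delta_minus_le in \<open>auto intro!: l2_eqI simp: entry_simps algebra_simps\<close>)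

text \<open>Summation by parts: this makes the lattice energies conserved.\<close>

lemma inner_delta_plus: "inner (delta_plus x) y = - inner x (delta_minus y)"
proof -
  have "bij_betw (\<lambda>j::int. j + 1) UNIV UNIV"
    by (rule bij_betwI[of _ _ _ "\<lambda>j. j - 1"]) auto
  from infsum_reindex_bij_betw[OF this, of "\<lambda>j. entry x j * entry y (j - 1)"]
  have "inner (shift 1 x) y = inner x (shift (-1) y)"
    by (simp add: inner_l2_def entry_shift)
  then show ?thesis
    by (simp add: delta_plus_eq_shift delta_minus_eq_shift inner_diff_left inner_diff_right)
qed

lemma bounded_linear_weight_entries:
  assumes "continuous_on UNIV f"
  shows "bounded_linear (weight_entries f x)"
proof -
  obtain B where B: "\<And>t. \<bar>t\<bar> \<le> norm x \<Longrightarrow> \<bar>f t\<bar> \<le> B"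
    using bounded_on_entries[OF assms] by blast
  have "0 \<le> B"
    using B[of 0] by simp
  have "norm (weight_entries f x y) \<le> B * norm y" for y
    using \<open>0 \<le> B\<close>
    by (intro norm_le_of_entries)
      (auto simp: entry_weight_entries[OF assms] abs_mult intro!: mult_right_mono B abs_entry_le_norm)
  then show ?thesis
    by (intro bounded_linear_intro[where K = B])
      (auto intro!: l2_eqI simp: entry_simps entry_weight_entries[OF assms] algebra_simps)
qed

lemma norm_weight_entries_le:
  assumes "continuous_on UNIV f" and "\<And>u. \<bar>u\<bar> \<le> M \<Longrightarrow> \<bar>f u\<bar> \<le> B" and "norm x \<le> M"
  shows "norm (weight_entries f x y) \<le> B * norm y"
proof (rule norm_le_of_entries)
  have bound: "\<bar>f (entry x j)\<bar> \<le> B" for j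
    using assms(2,3) abs_entry_le_norm[of x j] by force
  then show "\<bar>entry (weight_entries f x y) j\<bar> \<le> B * \<bar>entry y j\<bar>" for j
    by (simp add: entry_weight_entries[OF assms(1)] abs_mult mult_right_mono)
  show "0 \<le> B"
    using bound[of 0] by linarith
qed

text \<open>The weight function \<open>\<lambda>u. u\<close> turns \<open>weight_entries\<close> into the entrywise product, under which
  the space is a Banach algebra because the supremum norm is at most the \<open>\<ell>\<^sup>2\<close> norm.\<close>

abbreviation times_entries :: "l2 \<Rightarrow> l2 \<Rightarrow> l2"
  where "times_entries \<equiv> weight_entries (\<lambda>u. u)"

lemma norm_times_entries_le: "norm (times_entries x y) \<le> norm x * norm y"
  by (rule norm_weight_entries_le[where M = "norm x"]) auto

lemma bounded_bilinear_times_entries: "bounded_bilinear times_entries"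
proof
  show "\<exists>K. \<forall>a b. norm (times_entries a b) \<le> norm a * norm b * K"
    by (rule exI[of _ 1]) (simp add: norm_times_entries_le)
qed (auto intro!: l2_eqI simp: entry_simps entry_weight_entries algebra_simps)

lemma lipschitz_of_deriv_bound:
  fixes f f' :: "real \<Rightarrow> real"
  assumes "\<And>t. (f has_real_derivative f' t) (at t)"
    and "\<And>t. \<bar>t\<bar> \<le> M \<Longrightarrow> \<bar>f' t\<bar> \<le> B" and "\<bar>u\<bar> \<le> M" "\<bar>v\<bar> \<le> M"
  shows "\<bar>f v - f u\<bar> \<le> B * \<bar>v - u\<bar>"
proof -
  have "norm (f v - f u) \<le> B * norm (v - u)"
  proof (rule field_differentiable_bound[of "{- M..M}" f f'])
    show "(f has_field_derivative f' s) (at s within {- M..M})" for s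
      using assms(1) has_field_derivative_at_within by blast
    show "norm (f' s) \<le> B" if "s \<in> {- M..M}" for s
      using that by (auto intro!: assms(2))
  qed (use assms in auto)
  then show ?thesis by simp
qed

text \<open>The constant is not the sharp one; only the quadratic order of the remainder matters.\<close>

lemma taylor_remainder_le:
  fixes f f' f'' :: "real \<Rightarrow> real"
  assumes f: "\<And>t. (f has_real_derivative f' t) (at t)"
    and f': "\<And>t. (f' has_real_derivative f'' t) (at t)"
    and bound: "\<And>t. \<bar>t\<bar> \<le> M \<Longrightarrow> \<bar>f'' t\<bar> \<le> B" and "\<bar>u\<bar> \<le> M" "\<bar>v\<bar> \<le> M"
  shows "\<bar>f v - f u - f' u * (v - u)\<bar> \<le> B * (v - u)\<^sup>2"
proof -
  let ?g = "\<lambda>s. f s - f' u * s"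
  have "0 \<le> B"
    using bound[of u] assms(4) by linarith
  have "norm (?g v - ?g u) \<le> (B * \<bar>v - u\<bar>) * norm (v - u)"
  proof (rule field_differentiable_bound[of "closed_segment u v" ?g "\<lambda>s. f' s - f' u"])
    show "(?g has_field_derivative f' s - f' u) (at s within closed_segment u v)" for s
      by (auto intro!: derivative_eq_intros has_field_derivative_at_within[OF f])
    show "norm (f' s - f' u) \<le> B * \<bar>v - u\<bar>" if "s \<in> closed_segment u v" for s
    proof -
      have s: "\<bar>s\<bar> \<le> M" "\<bar>s - u\<bar> \<le> \<bar>v - u\<bar>"
        using that assms(4,5) by (auto simp: closed_segment_eq_real_ivl split: if_splits)
      have "\<bar>f' s - f' u\<bar> \<le> B * \<bar>s - u\<bar>"
        by (rule lipschitz_of_deriv_bound[OF f' bound]) (use s assms in auto)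
      also have "\<dots> \<le> B * \<bar>v - u\<bar>"
        using s \<open>0 \<le> B\<close> by (intro mult_left_mono) auto
      finally show ?thesis by simp
    qed
  qed auto
  then show ?thesis
    by (simp add: right_diff_distrib power2_eq_square mult.assoc diff_diff_eq2 algebra_simps)
qed

lemma bounded_on_compact_interval:
  fixes f :: "real \<Rightarrow> real"
  assumes "continuous_on UNIV f"
  obtains B where "1 \<le> B" "\<And>t. \<bar>t\<bar> \<le> M \<Longrightarrow> \<bar>f t\<bar> \<le> B"
proof -
  have "compact (f ` {- M..M})"
    using assms by (intro compact_continuous_image) (auto intro: continuous_on_subset)
  then obtain B where "\<forall>y \<in> f ` {- M..M}. norm y \<le> B"
    using compact_imp_bounded bounded_iff by blast
  then have "\<bar>f t\<bar> \<le> max 1 B" if "\<bar>t\<bar> \<le> M" for t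
    using that by (intro max.coboundedI2) (auto simp: abs_le_iff)
  then show ?thesis by (intro that[of "max 1 B"]) auto
qed

lemma has_derivative_of_quadratic_remainder:
  fixes F :: "'a::real_normed_vector \<Rightarrow> 'b::real_normed_vector"
  assumes L: "bounded_linear L"
    and rem: "\<And>h. norm h \<le> 1 \<Longrightarrow> norm (F (x + h) - F x - L h) \<le> C * (norm h)\<^sup>2"
  shows "(F has_derivative L) (at x)"
  unfolding has_derivative_at
proof (intro conjI L)
  show "(\<lambda>h. norm (F (x + h) - F x - L h) / norm h) \<midarrow>0\<rightarrow> 0"
  proof (rule tendsto_sandwich[of "\<lambda>_. 0" _ _ "\<lambda>h. C * norm h"])
    have "\<forall>\<^sub>F h in at 0. norm h \<le> 1 \<and> (h::'a) \<noteq> 0"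
      unfolding eventually_at by (rule exI[of _ 1]) (auto simp: dist_norm)
    then show "\<forall>\<^sub>F h in at 0. norm (F (x + h) - F x - L h) / norm h \<le> C * norm h"
      by eventually_elim
        (use rem in \<open>auto simp: divide_le_eq power2_eq_square mult.assoc\<close>)
    have "((\<lambda>h::'a. C * norm h) \<longlongrightarrow> C * norm (0::'a)) (at 0)"
      by (intro tendsto_intros)
    then show "((\<lambda>h::'a. C * norm h) \<longlongrightarrow> 0) (at 0)" by simp
  qed auto
qed

text \<open>
  The Taylor remainder is entrywise at most \<open>B h\<^sub>j\<^sup>2\<close>, and the sequence of these squares
  has \<open>\<ell>\<^sup>2\<close> norm at most \<open>\<parallel>h\<parallel>\<^sup>2\<close>; entries are bounded by the norm, so \<open>f''\<close> is
  only evaluated on a compact interval.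
\<close>

lemma has_derivative_map_entries:
  fixes f f' f'' :: "real \<Rightarrow> real"
  assumes f: "\<And>t. (f has_real_derivative f' t) (at t)"
    and f': "\<And>t. (f' has_real_derivative f'' t) (at t)"
    and "continuous_on UNIV f''" and "f 0 = 0"
  shows "(map_entries f has_derivative weight_entries f' x) (at x)"
proof -
  have cont: "continuous_on UNIV f'"
    by (meson DERIV_isCont continuous_at_imp_continuous_on f')
  obtain B where B: "1 \<le> B" and bound: "\<And>t. \<bar>t\<bar> \<le> norm x + 1 \<Longrightarrow> \<bar>f'' t\<bar> \<le> B"
    using bounded_on_compact_interval assms(3) by blast
  have "0 \<le> B"
    using B by simp
  show ?thesis
  proof (rule has_derivative_of_quadratic_remainder[OF bounded_linear_weight_entries[OF cont]])
    fix h :: l2 assume h: "norm h \<le> 1"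
    let ?e = "map_entries f (x + h) - map_entries f x - weight_entries f' x h"
    have "norm ?e \<le> B * norm (times_entries h h)"
    proof (rule norm_le_of_entries[OF _ \<open>0 \<le> B\<close>])
      fix j
      have "\<bar>entry x j\<bar> \<le> norm x + 1" "\<bar>entry (x + h) j\<bar> \<le> norm x + 1"
        using abs_entry_le_norm[of x j] abs_entry_le_norm[of "x + h" j] norm_triangle_ineq[of x h] h
        by linarith+
      from taylor_remainder_le[OF f f' bound this]
      show "\<bar>entry ?e j\<bar> \<le> B * \<bar>entry (times_entries h h) j\<bar>"
        by (simp add: entry_simps entry_map_entries[OF f cont \<open>f 0 = 0\<close>] entry_weight_entries cont
            power2_eq_square)
    qed
    also have "\<dots> \<le> B * (norm h)\<^sup>2"
      using norm_times_entries_le[of h h] \<open>0 \<le> B\<close> by (simp add: power2_eq_square mult_left_mono)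
    finally show "norm ?e \<le> B * (norm h)\<^sup>2" .
  qed
qed

lemma has_vector_derivative_map_entries:
  fixes f f' f'' :: "real \<Rightarrow> real"
  assumes "\<And>t. (f has_real_derivative f' t) (at t)"
    and "\<And>t. (f' has_real_derivative f'' t) (at t)"
    and "continuous_on UNIV f''" and "f 0 = 0"
    and R: "(R has_vector_derivative D) (at t within J)"
  shows "((\<lambda>s. map_entries f (R s)) has_vector_derivative weight_entries f' (R t) D)
    (at t within J)"
proof -
  have cont: "continuous_on UNIV f'"
    by (meson DERIV_isCont continuous_at_imp_continuous_on assms(2))
  have "(map_entries f \<circ> R has_derivative weight_entries f' (R t) \<circ> (\<lambda>h. h *\<^sub>R D)) (at t within J)"
    using R has_derivative_map_entries[OF assms(1-4)]
    by (intro diff_chain_within) (auto simp: has_vector_derivative_def has_derivative_at_withinI)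
  then show ?thesis
    by (simp add: has_vector_derivative_def o_def
        bounded_linear.linear[OF bounded_linear_weight_entries[OF cont], THEN linear_scale])
qed

lemma norm_map_entries_diff_le:
  assumes f: "\<And>t. (f has_real_derivative f' t) (at t)" and "continuous_on UNIV f'" and "f 0 = 0"
    and bound: "\<And>u. \<bar>u\<bar> \<le> M \<Longrightarrow> \<bar>f' u\<bar> \<le> B" and "norm x \<le> M" "norm y \<le> M"
  shows "norm (map_entries f x - map_entries f y) \<le> B * norm (x - y)"
proof (rule norm_le_of_entries)
  show "0 \<le> B"
    using bound[of 0] order_trans[OF norm_ge_zero \<open>norm x \<le> M\<close>] by simp
  have "\<bar>f (entry x j) - f (entry y j)\<bar> \<le> B * \<bar>entry x j - entry y j\<bar>" for j
    using abs_entry_le_norm[of x j] abs_entry_le_norm[of y j] assms(5,6)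
    by (intro lipschitz_of_deriv_bound[where M = M, OF f bound]) auto
  then show "\<bar>entry (map_entries f x - map_entries f y) j\<bar> \<le> B * \<bar>entry (x - y) j\<bar>" for j
    by (simp add: entry_simps entry_map_entries[OF assms(1-3)])
qed

lemma map_entries_zero: "f 0 = 0 \<Longrightarrow> map_entries f 0 = 0"
  by (rule l2_eqI) (simp add: map_entries_def entry_l2_of_seq entry_simps)


section \<open>Potential energy\<close>

definition potential_energy :: "(real \<Rightarrow> real) \<Rightarrow> l2 \<Rightarrow> real"
  where "potential_energy V x = (\<Sum>\<^sub>\<infinity>j. V (entry x j))"

lemma norm_square_eq_infsum: "(norm x)\<^sup>2 = (\<Sum>\<^sub>\<infinity>j. (entry x j)\<^sup>2)"
  by (simp add: norm_l2_def infsum_nonneg)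

lemma abs_infsum_le_norm_square:
  assumes "\<And>j. \<bar>g j\<bar> \<le> C * (entry x j)\<^sup>2"
  shows "g summable_on UNIV" and "\<bar>\<Sum>\<^sub>\<infinity>j. g j\<bar> \<le> C * (norm x)\<^sup>2"
proof -
  have sq: "(\<lambda>j. C * (entry x j)\<^sup>2) summable_on UNIV"
    by (intro summable_on_cmult_right square_summable_entry)
  have abs: "(\<lambda>j. \<bar>g j\<bar>) summable_on UNIV"
    by (rule summable_on_comparison_test[OF sq]) (use assms in auto)
  then show "g summable_on UNIV"
    by (rule abs_summable_summable[of g, simplified])
  have "\<bar>\<Sum>\<^sub>\<infinity>j. g j\<bar> \<le> (\<Sum>\<^sub>\<infinity>j. \<bar>g j\<bar>)"
    using norm_infsum_bound[of g UNIV] abs by simp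
  also have "\<dots> \<le> (\<Sum>\<^sub>\<infinity>j. C * (entry x j)\<^sup>2)"
    using assms by (intro infsum_mono abs sq)
  also have "\<dots> = C * (norm x)\<^sup>2"
    by (simp add: norm_square_eq_infsum infsum_cmult_right')
  finally show "\<bar>\<Sum>\<^sub>\<infinity>j. g j\<bar> \<le> C * (norm x)\<^sup>2" .
qed

lemma infsum_minus:
  fixes f g :: "int \<Rightarrow> real"
  assumes "f summable_on A" "g summable_on A"
  shows "(\<lambda>j. f j - g j) summable_on A"
    and "(\<Sum>\<^sub>\<infinity>j\<in>A. f j - g j) = (\<Sum>\<^sub>\<infinity>j\<in>A. f j) - (\<Sum>\<^sub>\<infinity>j\<in>A. g j)"
proof -
  have g: "(\<lambda>j. - g j) summable_on A"
    using assms(2) by (simp add: summable_on_uminus)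
  show "(\<lambda>j. f j - g j) summable_on A"
    using summable_on_add[OF assms(1) g] by simp
  show "(\<Sum>\<^sub>\<infinity>j\<in>A. f j - g j) = (\<Sum>\<^sub>\<infinity>j\<in>A. f j) - (\<Sum>\<^sub>\<infinity>j\<in>A. g j)"
    using infsum_add[OF assms(1) g] by (simp add: infsum_uminus)
qed

lemma smooth_derivs:
  assumes "smooth V"
  shows "(V has_real_derivative deriv V t) (at t)"
    and "(deriv V has_real_derivative deriv (deriv V) t) (at t)"
    and "(deriv (deriv V) has_real_derivative deriv (deriv (deriv V)) t) (at t)"
    and "(deriv (deriv (deriv V)) has_real_derivative deriv (deriv (deriv (deriv V))) t) (at t)"
    and "continuous_on UNIV (deriv (deriv V))"
    and "continuous_on UNIV (deriv (deriv (deriv V)))"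
    and "continuous_on UNIV (deriv (deriv (deriv (deriv V))))"
  using smooth_has_derivs(1)[OF assms, of 0] smooth_has_derivs(1)[OF assms, of 1]
    smooth_has_derivs(1)[OF assms, of 2] smooth_has_derivs(1)[OF assms, of 3]
    smooth_has_derivs(2)[OF assms, of 2] smooth_has_derivs(2)[OF assms, of 3]
    smooth_has_derivs(2)[OF assms, of 4]
  by (simp_all add: eval_nat_numeral)

lemma summable_potential:
  assumes "smooth V" "V 0 = 0" "deriv V 0 = 0"
  shows "(\<lambda>j. V (entry x j)) summable_on UNIV"
proof -
  obtain B where B: "1 \<le> B" "\<And>t. \<bar>t\<bar> \<le> norm x \<Longrightarrow> \<bar>deriv (deriv V) t\<bar> \<le> B"
    using bounded_on_compact_interval smooth_derivs(5)[OF assms(1)] by blast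
  have "\<bar>V (entry x j)\<bar> \<le> B * (entry x j)\<^sup>2" for j
    using taylor_remainder_le[OF smooth_derivs(1,2)[OF assms(1)] B(2), where u = 0 and v = "entry x j"]
      abs_entry_le_norm[of x j] assms(2,3) by simp
  then show ?thesis
    by (rule abs_infsum_le_norm_square(1))
qed

lemma has_derivative_potential_energy:
  assumes V: "smooth V" "V 0 = 0" "deriv V 0 = 0"
  shows "(potential_energy V has_derivative (\<lambda>h. inner (map_entries (deriv V) x) h)) (at x)"
proof -
  note d = smooth_derivs[OF V(1)]
  obtain B where B: "1 \<le> B" "\<And>t. \<bar>t\<bar> \<le> norm x + 1 \<Longrightarrow> \<bar>deriv (deriv V) t\<bar> \<le> B"
    using bounded_on_compact_interval d(5) by blast
  show ?thesis
  proof (rule has_derivative_of_quadratic_remainder[OF bounded_linear_inner_right])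
    fix h :: l2 assume h: "norm h \<le> 1"
    let ?g = "\<lambda>j. V (entry (x + h) j) - V (entry x j)
      - entry (map_entries (deriv V) x) j * entry h j"
    have "\<bar>?g j\<bar> \<le> B * (entry h j)\<^sup>2" for j
    proof -
      have "\<bar>entry x j\<bar> \<le> norm x + 1" "\<bar>entry (x + h) j\<bar> \<le> norm x + 1"
        using abs_entry_le_norm[of x j] abs_entry_le_norm[of "x + h" j] norm_triangle_ineq[of x h] h
        by linarith+
      from taylor_remainder_le[OF d(1,2) B(2) this] show ?thesis
        by (simp add: entry_simps entry_map_entries_deriv[OF V(1,3)])
    qed
    from abs_infsum_le_norm_square(2)[OF this]
    have "\<bar>\<Sum>\<^sub>\<infinity>j. ?g j\<bar> \<le> B * (norm h)\<^sup>2" .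
    moreover have "(\<Sum>\<^sub>\<infinity>j. ?g j) = potential_energy V (x + h) - potential_energy V x
      - inner (map_entries (deriv V) x) h"
    proof -
      have s: "(\<lambda>j. entry (map_entries (deriv V) x) j * entry h j) summable_on UNIV"
        by (intro summable_on_mult_square square_summable_entry)
      note p = summable_potential[OF V]
      have "(\<Sum>\<^sub>\<infinity>j. ?g j) = (\<Sum>\<^sub>\<infinity>j. V (entry (x + h) j) - V (entry x j))
          - (\<Sum>\<^sub>\<infinity>j. entry (map_entries (deriv V) x) j * entry h j)"
        by (rule infsum_minus(2)[OF infsum_minus(1)[OF p p] s])
      then show ?thesis
        by (simp add: potential_energy_def inner_l2_def infsum_minus(2)[OF p p])
    qed
    ultimately show "norm (potential_energy V (x + h) - potential_energy V x
        - inner (map_entries (deriv V) x) h) \<le> B * (norm h)\<^sup>2"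
      by simp
  qed
qed

lemma has_vector_derivative_potential_energy:
  assumes V: "smooth V" "V 0 = 0" "deriv V 0 = 0"
    and R: "(R has_vector_derivative D) (at t within J)"
  shows "((\<lambda>s. potential_energy V (R s)) has_vector_derivative
    inner (map_entries (deriv V) (R t)) D) (at t within J)"
proof -
  have "(potential_energy V \<circ> R has_derivative
      (\<lambda>h. inner (map_entries (deriv V) (R t)) h) \<circ> (\<lambda>h. h *\<^sub>R D)) (at t within J)"
    using R has_derivative_potential_energy[OF V]
    by (intro diff_chain_within) (auto simp: has_vector_derivative_def has_derivative_at_withinI)
  then show ?thesis
    by (simp add: has_vector_derivative_def o_def)
qed

text \<open>
  On an interval where \<open>V''\<close> is within \<open>k/4\<close> of \<open>k\<close>, the function \<open>V(u) - k u\<^sup>2/2\<close> is at most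
  \<open>k u\<^sup>2/4\<close> in absolute value by Taylor's formula; the bounds are the sum of this over all entries.
\<close>

lemma potential_energy_near_quadratic:
  assumes V: "smooth V" "V 0 = 0" "deriv V 0 = 0" and k: "deriv (deriv V) 0 = k" "k > 0"
  obtains \<delta> where "\<delta> > 0"
    "\<And>x. norm x \<le> \<delta> \<Longrightarrow> k / 4 * (norm x)\<^sup>2 \<le> potential_energy V x"
    "\<And>x. norm x \<le> \<delta> \<Longrightarrow> potential_energy V x \<le> k * (norm x)\<^sup>2"
proof -
  note d = smooth_derivs[OF V(1)]
  have "isCont (deriv (deriv V)) 0"
    using d(3) DERIV_isCont by blast
  then obtain \<delta>' where \<delta>': "\<delta>' > 0" "\<And>u. \<bar>u\<bar> < \<delta>' \<Longrightarrow> \<bar>deriv (deriv V) u - k\<bar> < k / 4"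
    using k unfolding continuous_at_eps_delta
    by (metis diff_zero dist_real_def divide_pos_pos zero_less_numeral)
  define \<delta> where "\<delta> = \<delta>' / 2"
  have \<delta>: "\<delta> > 0" "\<And>u. \<bar>u\<bar> \<le> \<delta> \<Longrightarrow> \<bar>deriv (deriv V) u - k\<bar> \<le> k / 4"
    using \<delta>' by (auto simp: \<delta>_def intro!: less_imp_le)
  have near: "\<bar>potential_energy V x - k / 2 * (norm x)\<^sup>2\<bar> \<le> k / 4 * (norm x)\<^sup>2" if x: "norm x \<le> \<delta>" for x
  proof -
    have "\<bar>V (entry x j) - k / 2 * (entry x j)\<^sup>2\<bar> \<le> k / 4 * (entry x j)\<^sup>2" for j
    proof -
      have "((\<lambda>u. V u - k / 2 * u\<^sup>2) has_real_derivative deriv V u - k * u) (at u)"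
        "((\<lambda>u. deriv V u - k * u) has_real_derivative deriv (deriv V) u - k) (at u)" for u
        by (auto intro!: derivative_eq_intros d)
      from taylor_remainder_le[OF this \<delta>(2), where u = 0 and v = "entry x j"] show ?thesis
        using V \<delta>(1) abs_entry_le_norm[of x j] x by simp
    qed
    from abs_infsum_le_norm_square(2)[OF this]
    have "\<bar>\<Sum>\<^sub>\<infinity>j. V (entry x j) - k / 2 * (entry x j)\<^sup>2\<bar> \<le> k / 4 * (norm x)\<^sup>2" .
    moreover have "(\<Sum>\<^sub>\<infinity>j. V (entry x j) - k / 2 * (entry x j)\<^sup>2)
        = potential_energy V x - k / 2 * (norm x)\<^sup>2"
      unfolding potential_energy_def norm_square_eq_infsum infsum_cmult_right'[symmetric]
      by (intro infsum_minus(2) summable_potential V summable_on_cmult_right square_summable_entry)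
    ultimately show ?thesis by simp
  qed
  show ?thesis
  proof (rule that[OF \<delta>(1)])
    fix x :: l2 assume "norm x \<le> \<delta>"
    note abs_le_D1[OF near[OF this]] abs_le_D2[OF near[OF this]]
    moreover have "0 \<le> k * (norm x)\<^sup>2"
      using k by simp
    ultimately show "k / 4 * (norm x)\<^sup>2 \<le> potential_energy V x"
      "potential_energy V x \<le> k * (norm x)\<^sup>2"
      by linarith+
  qed
qed


section \<open>Differential inequalities and continuation\<close>

lemma has_real_derivative_norm_square:
  fixes f :: "real \<Rightarrow> 'a::real_inner"
  assumes "(f has_vector_derivative D) (at t within S)"
  shows "((\<lambda>s. (norm (f s))\<^sup>2) has_real_derivative 2 * inner (f t) D) (at t within S)"
  using bounded_bilinear.has_vector_derivative[OF bounded_bilinear_inner assms assms]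
  by (simp add: has_real_derivative_iff_has_vector_derivative power2_norm_eq_inner inner_commute)

text \<open>
  The end point \<open>t\<close> may have either sign: along \<open>u \<mapsto> u t\<close> the interval becomes \<open>[0, 1]\<close>, where
  \<open>(G + D) exp (- A \<bar>t\<bar> u)\<close> is nonincreasing.
\<close>

lemma gronwall_two_sided:
  fixes G G' :: "real \<Rightarrow> real"
  assumes der: "\<And>s. s \<in> closed_segment 0 t \<Longrightarrow>
      (G has_real_derivative G' s) (at s within closed_segment 0 t)"
    and bound: "\<And>s. s \<in> closed_segment 0 t \<Longrightarrow> \<bar>G' s\<bar> \<le> A * G s + D"
    and "1 \<le> A" "0 \<le> D"
  shows "G t \<le> (G 0 + D) * exp (A * \<bar>t\<bar>)"
proof -
  let ?f = "\<lambda>u. (G (u * t) + D) * exp (- (A * \<bar>t\<bar>) * u)"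
  let ?f' = "\<lambda>u. (G' (u * t) * t - (A * \<bar>t\<bar>) * (G (u * t) + D)) * exp (- (A * \<bar>t\<bar>) * u)"
  have seg: "u * t \<in> closed_segment 0 t" if "u \<in> {0..1}" for u
    using that by (auto simp: closed_segment_def)
  have f: "(?f has_real_derivative ?f' u) (at u within {0..1})" if u: "u \<in> {0..1}" for u
  proof -
    have "(G has_real_derivative G' (u * t)) (at (u * t) within (\<lambda>u. u * t) ` {0..1})"
      by (rule DERIV_subset[OF der[OF seg[OF u]]]) (use seg in auto)
    moreover have "((\<lambda>u. u * t) has_real_derivative t) (at u within {0..1})"
      by (auto intro!: derivative_eq_intros)
    ultimately have "((\<lambda>u. G (u * t)) has_real_derivative G' (u * t) * t) (at u within {0..1})"
      using DERIV_image_chain[of G _ "\<lambda>u. u * t" u] by (simp add: o_def)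
    then have "((\<lambda>u. G (u * t) + D) has_real_derivative G' (u * t) * t) (at u within {0..1})"
      by (auto intro!: derivative_eq_intros)
    moreover have "((\<lambda>u. exp (- (A * \<bar>t\<bar>) * u)) has_real_derivative
        exp (- (A * \<bar>t\<bar>) * u) * - (A * \<bar>t\<bar>)) (at u within {0..1})"
      by (auto intro!: derivative_eq_intros)
    ultimately show ?thesis
      by (rule DERIV_cong[OF DERIV_mult]) (simp add: algebra_simps)
  qed
  have neg: "?f' u \<le> 0" if u: "u \<in> {0..1}" for u
  proof -
    have "G' (u * t) * t \<le> \<bar>G' (u * t)\<bar> * \<bar>t\<bar>"
      by (metis abs_ge_self abs_mult)
    also have "\<dots> \<le> (A * G (u * t) + D) * \<bar>t\<bar>"
      by (intro mult_right_mono bound seg u) auto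
    also have "\<dots> \<le> (A * G (u * t) + A * D) * \<bar>t\<bar>"
      using assms(3,4) mult_right_mono[of 1 A D] by (intro mult_right_mono) auto
    finally show ?thesis
      by (intro mult_nonpos_nonneg) (auto simp: algebra_simps)
  qed
  have "?f 1 \<le> ?f 0"
  proof (rule DERIV_nonpos_imp_decreasing_open[of 0 1])
    show "\<exists>y. DERIV ?f x :> y \<and> y \<le> 0" if "0 < x" "x < 1" for x
    proof (intro exI conjI)
      show "DERIV ?f x :> ?f' x"
        using f[of x] that by (simp add: at_within_Icc_at)
      show "?f' x \<le> 0"
        using that by (intro neg) simp
    qed
    show "continuous_on {0..1} ?f"
      unfolding continuous_on_eq_continuous_within by (intro ballI DERIV_continuous[OF f])
  qed auto
  then have "(G t + D) * exp (- (A * \<bar>t\<bar>)) \<le> G 0 + D"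
    by simp
  then have "(G t + D) * exp (- (A * \<bar>t\<bar>)) * exp (A * \<bar>t\<bar>) \<le> (G 0 + D) * exp (A * \<bar>t\<bar>)"
    by (rule mult_right_mono) simp
  then have "G t + D \<le> (G 0 + D) * exp (A * \<bar>t\<bar>)"
    by (simp add: mult.assoc flip: exp_add)
  then show ?thesis
    using assms(4) by linarith
qed

text \<open>
  A bootstrap argument in both time directions: if \<open>f\<close> ever reached the level \<open>r\<close>, then at the time
  closest to \<open>0\<close> on that side at which it does so it would equal \<open>r\<close>, while \<open>step\<close> makes it smaller.
\<close>

lemma continuation_bound:
  fixes f :: "real \<Rightarrow> real"
  assumes J: "is_interval J" "0 \<in> J" "t \<in> J" and cont: "continuous_on J f" and "f 0 < r"
    and step: "\<And>t. t \<in> J \<Longrightarrow> (\<And>s. s \<in> closed_segment 0 t \<Longrightarrow> f s \<le> r) \<Longrightarrow> f t < r"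
  shows "f t < r"
proof (rule ccontr)
  assume "\<not> f t < r"
  let ?g = "\<lambda>u. f (u * t)"
  have seg: "u * t \<in> J" if "u \<in> {0..1}" for u
  proof -
    have "u * t \<in> closed_segment 0 t"
      using that by (auto simp: closed_segment_def)
    then show ?thesis
      using closed_segment_subset[OF J(2,3)] J(1) is_interval_convex by blast
  qed
  have g: "continuous_on {0..1} ?g"
    by (rule continuous_on_compose2[OF cont]) (use seg in \<open>auto intro!: continuous_intros\<close>)
  have closed: "closed {u \<in> {0..1}. ?g u \<in> {r..}}"
    using continuous_closed_preimage[OF g, of "{r..}"] by (simp add: vimage_def Int_def)
  have compact: "compact {u \<in> {0..1}. ?g u \<in> {r..}}"
    using closed unfolding compact_eq_bounded_closed
    by (blast intro: bounded_subset[OF bounded_closed_interval[of 0 "1::real"]])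
  have "{u \<in> {0..1}. ?g u \<in> {r..}} \<noteq> {}"
    using \<open>\<not> f t < r\<close> by (auto intro!: exI[of _ 1])
  from compact_attains_inf[OF compact this]
  obtain m where m_least: "m \<in> {u \<in> {0..1}. ?g u \<in> {r..}}" "\<forall>u\<in>{u \<in> {0..1}. ?g u \<in> {r..}}. m \<le> u"
    by blast
  have m: "m \<in> {0..1}" "r \<le> ?g m"
    using m_least(1) by auto
  have least: "m \<le> u" if "u \<in> {0..1}" "r \<le> ?g u" for u
    using m_least(2) that by blast
  have "continuous_on {0..m} ?g"
    by (rule continuous_on_subset[OF g]) (use m in auto)
  then obtain u where "0 \<le> u" "u \<le> m" "?g u = r"
    using IVT'[of ?g 0 r m] m \<open>f 0 < r\<close> by auto
  then have "?g m = r"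
    using least[of u] m by auto
  have "f s \<le> r" if s: "s \<in> closed_segment 0 (m * t)" for s
  proof -
    obtain v where v: "0 \<le> v" "v \<le> 1" "s = (v * m) * t"
      using s by (auto simp: closed_segment_def)
    have "v * m \<le> m" "0 \<le> v * m"
      using v m by (auto simp: mult_left_le_one_le)
    then have "v * m = m" if "r \<le> ?g (v * m)"
      using least[OF _ that] m(1) by simp
    then show ?thesis
      using \<open>?g m = r\<close> v(3) by force
  qed
  from step[OF seg[OF m(1)] this] show False
    using m(2) by simp
qed


section \<open>Stability of the FPUT lattice\<close>

lemma FPUT_energy_conserved:
  assumes V: "smooth V" "V 0 = 0" "deriv V 0 = 0" and "0 < \<mu>"
    and J: "is_interval J" "0 \<in> J" "t \<in> J" and sol: "solves_FPUT V \<mu> J R P"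
  shows "potential_energy V (R t) + (1 + \<mu>) / 2 * (norm (P t))\<^sup>2
    = potential_energy V (R 0) + (1 + \<mu>) / 2 * (norm (P 0))\<^sup>2"
proof -
  let ?H = "\<lambda>s. potential_energy V (R s) + (1 + \<mu>) / 2 * (norm (P s))\<^sup>2"
  have "(?H has_vector_derivative 0) (at s within J)" if "s \<in> J" for s
  proof -
    have R: "(R has_vector_derivative delta_plus (P s)) (at s within J)"
      and P: "(P has_vector_derivative (1 / (1 + \<mu>)) *\<^sub>R delta_minus (map_entries (deriv V) (R s)))
        (at s within J)"
      using sol that by (auto simp: solves_FPUT_def)
    have "(?H has_real_derivative inner (map_entries (deriv V) (R s)) (delta_plus (P s))
        + (1 + \<mu>) / 2 * (2 * inner (P s) ((1 / (1 + \<mu>)) *\<^sub>R delta_minus (map_entries (deriv V) (R s)))))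
        (at s within J)"
      using has_vector_derivative_potential_energy[OF V R] has_real_derivative_norm_square[OF P]
      by (intro DERIV_add DERIV_cmult)
        (auto simp: has_real_derivative_iff_has_vector_derivative)
    also have "inner (map_entries (deriv V) (R s)) (delta_plus (P s))
        + (1 + \<mu>) / 2 * (2 * inner (P s) ((1 / (1 + \<mu>)) *\<^sub>R delta_minus (map_entries (deriv V) (R s)))) = 0"
      using \<open>0 < \<mu>\<close> inner_delta_plus[of "P s" "map_entries (deriv V) (R s)"]
      by (simp add: inner_commute[of "map_entries (deriv V) (R s)"])
    finally show ?thesis
      by (simp add: has_real_derivative_iff_has_vector_derivative)
  qed
  then obtain c where "\<And>s. s \<in> J \<Longrightarrow> ?H s = c"
    using has_vector_derivative_zero_constant[of J ?H] is_interval_convex[OF J(1)] by blast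
  then show ?thesis
    using J by metis
qed

text \<open>
  Lyapunov stability of the origin, uniformly in \<open>\<mu> \<le> 1\<close>.  In a ball of radius \<open>r\<close> where the
  potential energy lies between \<open>k/4 \<parallel>R\<parallel>\<^sup>2\<close> and \<open>k \<parallel>R\<parallel>\<^sup>2\<close>, data of size \<open>\<rho>\<close> have energy at most
  \<open>(k + 1) \<rho>\<^sup>2\<close>, which is less than the energy \<open>k r\<^sup>2/4\<close> needed to reach the boundary of the ball.
\<close>

lemma FPUT_stability:
  assumes V: "smooth V" "V 0 = 0" "deriv V 0 = 0" "deriv (deriv V) 0 > 0" and "\<epsilon> > 0"
  obtains \<rho> where "\<rho> > 0"
    "\<And>\<mu> J R P t. \<lbrakk>0 < \<mu>; \<mu> \<le> 1; is_interval J; 0 \<in> J; t \<in> J; solves_FPUT V \<mu> J R P;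
      norm (R 0) + norm (P 0) \<le> \<rho>\<rbrakk> \<Longrightarrow> norm (R t) \<le> \<epsilon> \<and> norm (P t) \<le> \<epsilon>"
proof -
  define k where "k = deriv (deriv V) 0"
  have k: "k > 0"
    using V by (simp add: k_def)
  obtain \<delta> where \<delta>: "\<delta> > 0"
    "\<And>x. norm x \<le> \<delta> \<Longrightarrow> k / 4 * (norm x)\<^sup>2 \<le> potential_energy V x"
    "\<And>x. norm x \<le> \<delta> \<Longrightarrow> potential_energy V x \<le> k * (norm x)\<^sup>2"
    using potential_energy_near_quadratic[OF V(1-3) k_def[symmetric] k] by blast
  define r where "r = min \<epsilon> \<delta>"
  have r: "r > 0" "r \<le> \<epsilon>" "r \<le> \<delta>"
    using \<delta>(1) \<open>\<epsilon> > 0\<close> by (auto simp: r_def)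
  \<comment> \<open>\<open>\<rho>\<^sup>2 = c r\<^sup>2\<close>; the factor \<open>min k 1\<close> makes the initial energy small both against \<open>k r\<^sup>2/4\<close>,
    which confines \<open>R\<close>, and against \<open>r\<^sup>2/2\<close>, which bounds \<open>P\<close>\<close>
  define c where "c = min k 1 / (8 * (k + 1))"
  have c: "c > 0" "(k + 1) * c < k / 4" "2 * ((k + 1) * c) \<le> 1" "c < 1"
  proof -
    define m where "m = min k 1"
    have m: "0 < m" "m \<le> k" "m \<le> 1"
      using k by (auto simp: m_def)
    have "(k + 1) * c = m / 8"
      using k by (simp add: c_def m_def[symmetric] divide_simps)
    then show "(k + 1) * c < k / 4" "2 * ((k + 1) * c) \<le> 1"
      using m k by auto
    show "c > 0" "c < 1"
      using m k by (auto simp: c_def m_def[symmetric])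
  qed
  define \<rho> where "\<rho> = sqrt c * r"
  have \<rho>: "\<rho> > 0" "\<rho>\<^sup>2 = c * r\<^sup>2" "\<rho> < r"
    using c r by (auto simp: \<rho>_def power_mult_distrib)
  show ?thesis
  proof (rule that[OF \<rho>(1)])
    fix \<mu> J R P t
    assume \<mu>: "0 < \<mu>" "\<mu> \<le> 1" and J: "is_interval J" "0 \<in> J" "t \<in> J"
      and sol: "solves_FPUT V \<mu> J R P" and init: "norm (R 0) + norm (P 0) \<le> \<rho>"
    let ?H0 = "potential_energy V (R 0) + (1 + \<mu>) / 2 * (norm (P 0))\<^sup>2"
    have R0: "norm (R 0) \<le> \<rho>" and P0: "norm (P 0) \<le> \<rho>"
      using init norm_ge_zero[of "R 0"] norm_ge_zero[of "P 0"] by linarith+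
    have "potential_energy V (R 0) \<le> k * (norm (R 0))\<^sup>2"
      using R0 \<rho>(3) r(3) by (intro \<delta>(3)) linarith
    also have "\<dots> \<le> k * \<rho>\<^sup>2"
      using k R0 by (intro mult_left_mono power_mono) auto
    finally have pot: "potential_energy V (R 0) \<le> k * \<rho>\<^sup>2" .
    have "(1 + \<mu>) / 2 * (norm (P 0))\<^sup>2 \<le> 1 * \<rho>\<^sup>2"
      using \<mu> P0 by (intro mult_mono power_mono) auto
    with pot have "?H0 \<le> (k + 1) * \<rho>\<^sup>2"
      unfolding distrib_right[of k 1] by (rule add_mono)
    then have H0: "?H0 \<le> (k + 1) * c * r\<^sup>2"
      by (simp add: \<rho>(2) mult.assoc)
    have energy: "k / 4 * (norm (R s))\<^sup>2 + 1 / 2 * (norm (P s))\<^sup>2 \<le> (k + 1) * c * r\<^sup>2"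
      if "s \<in> J" "norm (R s) \<le> r" for s
    proof -
      have "k / 4 * (norm (R s))\<^sup>2 \<le> potential_energy V (R s)"
        using that(2) r(3) by (intro \<delta>(2)) linarith
      moreover have "1 / 2 * (norm (P s))\<^sup>2 \<le> (1 + \<mu>) / 2 * (norm (P s))\<^sup>2"
        using \<mu> by (intro mult_right_mono) auto
      ultimately show ?thesis
        using FPUT_energy_conserved[OF V(1-3) \<mu>(1) J(1,2) that(1) sol] H0 by linarith
    qed
    have "norm (R t) < r"
    proof (rule continuation_bound[OF J, of "\<lambda>s. norm (R s)"])
      have "continuous_on J R"
        using sol unfolding solves_FPUT_def
        by (auto simp: continuous_on_eq_continuous_within intro: has_vector_derivative_continuous)
      then show "continuous_on J (\<lambda>s. norm (R s))"
        by (intro continuous_intros)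
      show "norm (R 0) < r"
        using R0 \<rho>(3) by simp
      show "norm (R s) < r" if s: "s \<in> J" "\<And>u. u \<in> closed_segment 0 s \<Longrightarrow> norm (R u) \<le> r" for s
      proof -
        have "k / 4 * (norm (R s))\<^sup>2 + 1 / 2 * (norm (P s))\<^sup>2 \<le> (k + 1) * c * r\<^sup>2"
          using energy[OF s(1)] s(2)[of s] by simp
        then have "k / 4 * (norm (R s))\<^sup>2 \<le> (k + 1) * c * r\<^sup>2"
          using zero_le_power2[of "norm (P s)"] by linarith
        also have "\<dots> < k / 4 * r\<^sup>2"
          using c(2) r(1) by (intro mult_strict_right_mono) auto
        finally have "(norm (R s))\<^sup>2 < r\<^sup>2"
          using k by simp
        then show ?thesis
          by (rule power2_less_imp_less) (use r(1) in simp)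
      qed
    qed
    from energy[OF J(3) less_imp_le[OF this]]
    have "1 / 2 * (norm (P t))\<^sup>2 \<le> (k + 1) * c * r\<^sup>2"
      using k mult_nonneg_nonneg[OF less_imp_le[OF k] zero_le_power2[of "norm (R t)"]] by linarith
    then have "(norm (P t))\<^sup>2 \<le> 2 * ((k + 1) * c) * r\<^sup>2"
      by simp
    then have "(norm (P t))\<^sup>2 \<le> r\<^sup>2"
      using mult_right_mono[OF c(3), of "r\<^sup>2"] by simp
    then have "norm (P t) \<le> r"
      by (rule power2_le_imp_le) (use r(1) in simp)
    then show "norm (R t) \<le> \<epsilon> \<and> norm (P t) \<le> \<epsilon>"
      using r(2) \<open>norm (R t) < r\<close> by simp
  qed
qed


section \<open>The driven oscillator follows its slow manifold\<close>

lemma has_vector_derivative_unscale: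
  fixes p :: "real \<Rightarrow> 'a::real_normed_vector"
  assumes "((\<lambda>s. \<mu> *\<^sub>R p s) has_vector_derivative D) (at t within S)" and "\<mu> > 0"
  shows "(p has_vector_derivative (1 / \<mu>) *\<^sub>R D) (at t within S)"
  using bounded_linear.has_vector_derivative[OF bounded_linear_scaleR_right assms(1), of "1 / \<mu>"]
    assms(2) by simp

lemma weighted_young:
  fixes x y c d :: real
  assumes "c > 0"
  shows "d * (x * y) \<le> c / 2 * x\<^sup>2 + d\<^sup>2 / (2 * c) * y\<^sup>2"
proof -
  have "0 \<le> (c * x - d * y)\<^sup>2 / (2 * c)"
    using assms by simp
  also have "\<dots> = c / 2 * x\<^sup>2 + d\<^sup>2 / (2 * c) * y\<^sup>2 - d * (x * y)"
    using assms by (simp add: power2_eq_square field_simps)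
  finally show ?thesis by simp
qed

text \<open>
  The forcing \<open>P\<close> varies slowly, so the oscillator stays near its slow manifold
  \<open>r = - (\<mu>/\<kappa>) A0\<close>, \<open>p = P - (\<mu>/\<kappa>) A1\<close>, where \<open>A0\<close>, \<open>A1\<close>, \<open>A2\<close> are the derivatives of \<open>P\<close>.  The
  deviation \<open>(q, v)\<close> is a free oscillator with forcing \<open>(\<mu>\<^sup>2/\<kappa>) A2\<close>.  The power this forcing feeds
  into the energy \<open>E\<close> is at most \<open>(\<mu>\<^sup>2/\<kappa>) M \<parallel>v\<parallel>\<close>, hence at most \<open>E + O(\<mu>\<^sup>3)\<close> by Young's
  inequality.  Thus \<open>E = O(\<mu>\<^sup>3)\<close>, and as \<open>E\<close> contains \<open>\<mu>/2 \<parallel>v\<parallel>\<^sup>2\<close>, this bounds \<open>v\<close> by \<open>O(\<mu>)\<close>.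
\<close>

lemma driven_oscillator_follows_drive:
  fixes r p P A0 A1 A2 :: "real \<Rightarrow> 'a::real_inner" and t :: real
  defines "S \<equiv> closed_segment 0 t"
  assumes pos: "0 < \<kappa>" "0 < \<mu>" "\<mu> \<le> 1"
    and r: "\<And>s. s \<in> S \<Longrightarrow> (r has_vector_derivative p s - P s) (at s within S)"
    and p: "\<And>s. s \<in> S \<Longrightarrow> ((\<lambda>s. \<mu> *\<^sub>R p s) has_vector_derivative - (\<kappa> *\<^sub>R r s)) (at s within S)"
    and P: "\<And>s. s \<in> S \<Longrightarrow> (P has_vector_derivative A0 s) (at s within S)"
    and A0: "\<And>s. s \<in> S \<Longrightarrow> (A0 has_vector_derivative A1 s) (at s within S)"
    and A1: "\<And>s. s \<in> S \<Longrightarrow> (A1 has_vector_derivative A2 s) (at s within S)"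
    and M: "\<And>s. s \<in> S \<Longrightarrow> norm (A1 s) \<le> M" "\<And>s. s \<in> S \<Longrightarrow> norm (A2 s) \<le> M"
    and init: "norm (r 0 + (\<mu> / \<kappa>) *\<^sub>R A0 0) \<le> N * \<mu>\<^sup>2"
      "sqrt \<mu> * norm (p 0 - P 0 + (\<mu> / \<kappa>) *\<^sub>R A1 0) \<le> N * \<mu>\<^sup>2"
    and "\<bar>t\<bar> \<le> T"
  shows "norm (p t - P t) \<le> (sqrt (((\<kappa> + 1) * N\<^sup>2 + M\<^sup>2 / \<kappa>\<^sup>2) * exp T) + M / \<kappa>) * \<mu>"
proof -
  define q where "q s = r s + (\<mu> / \<kappa>) *\<^sub>R A0 s" for s
  define v where "v s = p s - P s + (\<mu> / \<kappa>) *\<^sub>R A1 s" for s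
  define E where "E s = \<kappa> / 2 * (norm (q s))\<^sup>2 + \<mu> / 2 * (norm (v s))\<^sup>2" for s
  have q': "(q has_vector_derivative v s) (at s within S)" if "s \<in> S" for s
    unfolding q_def[abs_def] v_def using r[OF that] A0[OF that]
    by (auto intro!: derivative_eq_intros)
  have v': "(v has_vector_derivative (\<mu> / \<kappa>) *\<^sub>R A2 s - (\<kappa> / \<mu>) *\<^sub>R q s) (at s within S)" if "s \<in> S" for s
    unfolding v_def[abs_def] q_def
    using has_vector_derivative_unscale[OF p[OF that] pos(2)] P[OF that] A1[OF that] pos
    by (auto intro!: derivative_eq_intros simp: scaleR_add_right)
  have zero: "0 \<in> S" "t \<in> S"
    by (auto simp: S_def)
  have M0: "0 \<le> M"
    using M(1)[OF zero(1)] norm_ge_zero order_trans by blast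
  have E': "(E has_real_derivative \<mu>\<^sup>2 / \<kappa> * inner (v s) (A2 s)) (at s within S)" if "s \<in> S" for s
  proof -
    have "(E has_real_derivative \<kappa> / 2 * (2 * inner (q s) (v s))
        + \<mu> / 2 * (2 * inner (v s) ((\<mu> / \<kappa>) *\<^sub>R A2 s - (\<kappa> / \<mu>) *\<^sub>R q s))) (at s within S)"
      unfolding E_def[abs_def]
      by (intro DERIV_add DERIV_cmult has_real_derivative_norm_square q' v' that)
    then show ?thesis
      by (rule DERIV_cong)
        (use pos in \<open>simp add: inner_diff_right inner_commute[of "v s" "q s"] field_simps power2_eq_square\<close>)
  qed
  define D where "D = \<mu> ^ 3 * M\<^sup>2 / (2 * \<kappa>\<^sup>2)"
  have bound: "\<bar>\<mu>\<^sup>2 / \<kappa> * inner (v s) (A2 s)\<bar> \<le> 1 * E s + D" if s: "s \<in> S" for s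
  proof -
    have "\<bar>\<mu>\<^sup>2 / \<kappa> * inner (v s) (A2 s)\<bar> \<le> \<mu>\<^sup>2 / \<kappa> * (norm (v s) * norm (A2 s))"
      using pos Cauchy_Schwarz_ineq2[of "v s" "A2 s"]
      by (simp add: abs_mult mult_left_mono divide_right_mono)
    also have "\<dots> \<le> \<mu>\<^sup>2 / \<kappa> * (norm (v s) * M)"
      using pos M(2)[OF s] by (intro mult_left_mono) auto
    also have "\<dots> \<le> \<mu> / 2 * (norm (v s))\<^sup>2 + (\<mu>\<^sup>2 / \<kappa>)\<^sup>2 / (2 * \<mu>) * M\<^sup>2"
      by (rule weighted_young[OF pos(2)])
    also have "(\<mu>\<^sup>2 / \<kappa>)\<^sup>2 / (2 * \<mu>) * M\<^sup>2 = D"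
      using pos by (simp add: D_def field_simps power2_eq_square power3_eq_cube)
    also have "\<mu> / 2 * (norm (v s))\<^sup>2 + D \<le> 1 * E s + D"
      using pos by (simp add: E_def)
    finally show ?thesis .
  qed
  have "E t \<le> (E 0 + D) * exp (1 * \<bar>t\<bar>)"
    by (rule gronwall_two_sided[OF E'[unfolded S_def] bound[unfolded S_def]])
      (use pos in \<open>auto simp: D_def\<close>)
  also have "\<dots> \<le> ((\<kappa> + 1) / 2 * N\<^sup>2 * \<mu> ^ 3 + D) * exp T"
  proof (intro mult_mono)
    have \<mu>4: "\<mu> ^ 4 \<le> \<mu> ^ 3"
      using pos by (intro power_decreasing) auto
    have "(norm (q 0))\<^sup>2 \<le> (N * \<mu>\<^sup>2)\<^sup>2"
      using init(1) unfolding q_def by (intro power_mono) auto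
    also have "\<dots> = N\<^sup>2 * \<mu> ^ 4"
      by (simp add: power_mult_distrib)
    finally have q0: "(norm (q 0))\<^sup>2 \<le> N\<^sup>2 * \<mu> ^ 4" .
    have "(sqrt \<mu> * norm (v 0))\<^sup>2 \<le> (N * \<mu>\<^sup>2)\<^sup>2"
      using init(2) pos unfolding v_def by (intro power_mono) auto
    then have v0: "\<mu> * (norm (v 0))\<^sup>2 \<le> N\<^sup>2 * \<mu> ^ 4"
      using pos by (simp add: power_mult_distrib)
    have "E 0 \<le> \<kappa> / 2 * (N\<^sup>2 * \<mu> ^ 4) + 1 / 2 * (N\<^sup>2 * \<mu> ^ 4)"
      unfolding E_def using q0 v0 pos by (intro add_mono mult_left_mono) auto
    also have "\<dots> = (\<kappa> + 1) / 2 * N\<^sup>2 * \<mu> ^ 4"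
      by (simp add: field_simps)
    also have "\<dots> \<le> (\<kappa> + 1) / 2 * N\<^sup>2 * \<mu> ^ 3"
      using \<mu>4 pos by (intro mult_left_mono) auto
    finally show "E 0 + D \<le> (\<kappa> + 1) / 2 * N\<^sup>2 * \<mu> ^ 3 + D"
      by simp
  qed (use pos \<open>\<bar>t\<bar> \<le> T\<close> in \<open>auto simp: D_def\<close>)
  also have "\<dots> = ((\<kappa> + 1) * N\<^sup>2 + M\<^sup>2 / \<kappa>\<^sup>2) * exp T * \<mu> ^ 3 / 2"
    using pos by (simp add: D_def field_simps)
  finally have "E t \<le> ((\<kappa> + 1) * N\<^sup>2 + M\<^sup>2 / \<kappa>\<^sup>2) * exp T * \<mu> ^ 3 / 2" .
  moreover have "\<mu> / 2 * (norm (v t))\<^sup>2 \<le> E t"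
    using pos by (simp add: E_def)
  ultimately have "\<mu> / 2 * (norm (v t))\<^sup>2 \<le> ((\<kappa> + 1) * N\<^sup>2 + M\<^sup>2 / \<kappa>\<^sup>2) * exp T * \<mu> ^ 3 / 2"
    by (rule order_trans[rotated])
  also have "\<dots> = \<mu> / 2 * (((\<kappa> + 1) * N\<^sup>2 + M\<^sup>2 / \<kappa>\<^sup>2) * exp T * \<mu>\<^sup>2)"
    by (simp add: power2_eq_square power3_eq_cube)
  finally have "(norm (v t))\<^sup>2 \<le> ((\<kappa> + 1) * N\<^sup>2 + M\<^sup>2 / \<kappa>\<^sup>2) * exp T * \<mu>\<^sup>2"
    using pos by (simp only: mult_le_cancel_left_pos half_gt_zero)
  then have "norm (v t) \<le> sqrt (((\<kappa> + 1) * N\<^sup>2 + M\<^sup>2 / \<kappa>\<^sup>2) * exp T * \<mu>\<^sup>2)"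
    by (rule real_le_rsqrt)
  then have v: "norm (v t) \<le> sqrt (((\<kappa> + 1) * N\<^sup>2 + M\<^sup>2 / \<kappa>\<^sup>2) * exp T) * \<mu>"
    using pos by (simp add: real_sqrt_mult)
  have "norm (p t - P t) \<le> norm (v t) + norm ((\<mu> / \<kappa>) *\<^sub>R A1 t)"
    using norm_triangle_ineq4[of "v t" "(\<mu> / \<kappa>) *\<^sub>R A1 t"] by (simp add: v_def)
  also have "norm ((\<mu> / \<kappa>) *\<^sub>R A1 t) \<le> \<mu> / \<kappa> * M"
    using pos M(1)[OF zero(2)] by (simp add: mult_left_mono divide_right_mono)
  finally show ?thesis
    using v by (simp add: algebra_simps)
qed

text \<open>
  The factor \<open>a\<close> stands for \<open>1 / (1 + \<mu>)\<close>, so the derivatives of \<open>P\<close> are \<open>a F\<close>, \<open>a F1\<close>, \<open>a F2\<close>.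
  The differentiation of \<open>F1\<close> splits \<open>V''(R) = k + g(R)\<close> with \<open>g(0) = 0\<close>: then \<open>g(R)\<close> is itself
  square-summable, and the chain rule for entrywise maps and the Leibniz rule for the entrywise
  product apply.
\<close>

lemma FPUT_third_derivative:
  fixes V :: "real \<Rightarrow> real" and R P :: "real \<Rightarrow> l2"
  defines "F \<equiv> \<lambda>s. delta_minus (map_entries (deriv V) (R s))"
    and "F1 \<equiv> \<lambda>s. delta_minus (weight_entries (deriv (deriv V)) (R s) (delta_plus (P s)))"
  assumes V: "smooth V" "deriv V 0 = 0"
    and R: "\<And>s. s \<in> S \<Longrightarrow> (R has_vector_derivative delta_plus (P s)) (at s within S)"
    and P: "\<And>s. s \<in> S \<Longrightarrow> (P has_vector_derivative a *\<^sub>R F s) (at s within S)" and a: "\<bar>a\<bar> \<le> 1"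
    and small: "\<And>s. s \<in> S \<Longrightarrow> norm (R s) \<le> 1" "\<And>s. s \<in> S \<Longrightarrow> norm (P s) \<le> 1"
    and B: "1 \<le> B" "\<And>u. \<bar>u\<bar> \<le> 1 \<Longrightarrow> \<bar>deriv (deriv V) u\<bar> \<le> B"
      "\<And>u. \<bar>u\<bar> \<le> 1 \<Longrightarrow> \<bar>deriv (deriv (deriv V)) u\<bar> \<le> B"
  obtains F2 where
    "\<And>s. s \<in> S \<Longrightarrow> (F has_vector_derivative F1 s) (at s within S)"
    "\<And>s. s \<in> S \<Longrightarrow> (F1 has_vector_derivative F2 s) (at s within S)"
    "\<And>s. s \<in> S \<Longrightarrow> norm (F s) \<le> 16 * B\<^sup>2" "\<And>s. s \<in> S \<Longrightarrow> norm (F1 s) \<le> 16 * B\<^sup>2"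
    "\<And>s. s \<in> S \<Longrightarrow> norm (F2 s) \<le> 16 * B\<^sup>2"
proof
  note d = smooth_derivs[OF V(1)]
  define k where "k = deriv (deriv V) 0"
  define g where "g u = deriv (deriv V) u - k" for u
  define X where "X s = weight_entries (deriv (deriv V)) (R s) (delta_plus (P s))" for s
  define X' where "X' s = times_entries (weight_entries (deriv (deriv (deriv V))) (R s) (delta_plus (P s)))
    (delta_plus (P s)) + weight_entries (deriv (deriv V)) (R s) (delta_plus (a *\<^sub>R F s))" for s
  have g: "(g has_real_derivative deriv (deriv (deriv V)) u) (at u)" for u
    unfolding g_def[abs_def] by (auto intro!: derivative_eq_intros d)
  have split: "weight_entries (deriv (deriv V)) x y = k *\<^sub>R y + times_entries (map_entries g x) y" for x y
    by (rule l2_eqI)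
      (simp add: entry_simps entry_weight_entries d entry_map_entries[OF g d(6)] g_def k_def algebra_simps)
  have B2: "B \<le> B\<^sup>2"
    using B(1) by (simp add: power2_eq_square)
  fix s assume s: "s \<in> S"
  have dP: "((\<lambda>s. delta_plus (P s)) has_vector_derivative delta_plus (a *\<^sub>R F s)) (at s within S)"
    by (rule bounded_linear.has_vector_derivative[OF bounded_linear_delta_plus P[OF s]])
  have gR: "((\<lambda>s. map_entries g (R s)) has_vector_derivative
      weight_entries (deriv (deriv (deriv V))) (R s) (delta_plus (P s))) (at s within S)"
    by (rule has_vector_derivative_map_entries[OF g d(4) d(7) _ R[OF s]]) (simp add: g_def k_def)
  have "((\<lambda>s. k *\<^sub>R delta_plus (P s) + times_entries (map_entries g (R s)) (delta_plus (P s)))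
      has_vector_derivative k *\<^sub>R delta_plus (a *\<^sub>R F s)
      + (times_entries (map_entries g (R s)) (delta_plus (a *\<^sub>R F s))
        + times_entries (weight_entries (deriv (deriv (deriv V))) (R s) (delta_plus (P s)))
            (delta_plus (P s)))) (at s within S)"
    by (intro has_vector_derivative_add
        bounded_linear.has_vector_derivative[OF bounded_linear_scaleR_right]
        bounded_bilinear.has_vector_derivative[OF bounded_bilinear_times_entries] dP gR)
  then have X': "(X has_vector_derivative X' s) (at s within S)"
    unfolding X_def[abs_def] X'_def split by (simp add: add_ac)
  show "(F has_vector_derivative F1 s) (at s within S)"
    unfolding F_def F1_def
    by (intro bounded_linear.has_vector_derivative[OF bounded_linear_delta_minus]
        has_vector_derivative_map_entries[OF d(2,3,6) V(2)] R s)
  show "(F1 has_vector_derivative delta_minus (X' s)) (at s within S)"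
    unfolding F1_def X_def[symmetric]
    by (rule bounded_linear.has_vector_derivative[OF bounded_linear_delta_minus X'])
  have dPs: "norm (delta_plus (P s)) \<le> 2"
    using norm_delta_plus_le[of "P s"] small(2)[OF s] by simp
  have "norm (map_entries (deriv V) (R s) - map_entries (deriv V) 0) \<le> B * norm (R s - 0)"
    by (rule norm_map_entries_diff_le[OF d(2,5) V(2) B(2)]) (use small s in auto)
  also have "\<dots> \<le> B * 1"
    using small(1)[OF s] B(1) by (intro mult_left_mono) auto
  finally have F: "norm (F s) \<le> 2 * B"
    using norm_delta_minus_le[of "map_entries (deriv V) (R s)"]
    by (simp add: F_def map_entries_zero V(2))
  then show "norm (F s) \<le> 16 * B\<^sup>2"
    using B(1) B2 by linarith
  have "norm (X s) \<le> B * norm (delta_plus (P s))"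
    unfolding X_def by (rule norm_weight_entries_le[OF d(5) B(2) small(1)[OF s]])
  also have "\<dots> \<le> B * 2"
    using dPs B(1) by (intro mult_left_mono) auto
  finally have "norm (F1 s) \<le> 4 * B"
    using norm_delta_minus_le[of "X s"] by (simp add: F1_def X_def)
  then show "norm (F1 s) \<le> 16 * B\<^sup>2"
    using B(1) B2 by linarith
  have "norm (weight_entries (deriv (deriv (deriv V))) (R s) (delta_plus (P s)))
      \<le> B * norm (delta_plus (P s))"
    by (rule norm_weight_entries_le[OF d(6) B(3) small(1)[OF s]])
  also have "\<dots> \<le> B * 2"
    using dPs B(1) by (intro mult_left_mono) auto
  finally have "norm (times_entries (weight_entries (deriv (deriv (deriv V))) (R s) (delta_plus (P s)))
      (delta_plus (P s))) \<le> (B * 2) * 2"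
    using dPs B(1) by (intro order_trans[OF norm_times_entries_le] mult_mono) auto
  moreover have "norm (delta_plus (a *\<^sub>R F s)) \<le> 4 * B"
  proof -
    have "\<bar>a\<bar> * norm (F s) \<le> 1 * (2 * B)"
      using a F by (intro mult_mono) auto
    then show ?thesis
      using norm_delta_plus_le[of "a *\<^sub>R F s"] by simp
  qed
  then have "norm (weight_entries (deriv (deriv V)) (R s) (delta_plus (a *\<^sub>R F s))) \<le> B * (4 * B)"
    using B(1)
    by (intro order_trans[OF norm_weight_entries_le[OF d(5) B(2) small(1)[OF s]]] mult_left_mono) auto
  ultimately have "norm (X' s) \<le> (B * 2) * 2 + B * (4 * B)"
    unfolding X'_def by (intro order_trans[OF norm_triangle_ineq] add_mono)
  also have "\<dots> \<le> 8 * B\<^sup>2"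
    using B2 by (simp add: power2_eq_square)
  finally show "norm (delta_minus (X' s)) \<le> 16 * B\<^sup>2"
    using norm_delta_minus_le[of "X' s"] by simp
qed


section \<open>The error between the two lattices\<close>

lemma solves_subset:
  assumes "I \<subseteq> J"
  shows "solves_FPUT V \<mu> J R P \<Longrightarrow> solves_FPUT V \<mu> I R P"
    and "solves_driven_oscillator \<kappa> \<mu> P J r p \<Longrightarrow> solves_driven_oscillator \<kappa> \<mu> P I r p"
    and "solves_mass_in_mass V \<kappa> \<mu> J R P r p \<Longrightarrow> solves_mass_in_mass V \<kappa> \<mu> I R P r p"
proof -
  note sub = has_vector_derivative_within_subset[OF _ assms]
  show "solves_FPUT V \<mu> I R P" if "solves_FPUT V \<mu> J R P"
    using that assms unfolding solves_FPUT_def by (intro ballI conjI sub) auto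
  show "solves_driven_oscillator \<kappa> \<mu> P I r p" if "solves_driven_oscillator \<kappa> \<mu> P J r p"
    using that assms unfolding solves_driven_oscillator_def by (intro ballI conjI sub) auto
  show "solves_mass_in_mass V \<kappa> \<mu> I R P r p" if "solves_mass_in_mass V \<kappa> \<mu> J R P r p"
    using that assms unfolding solves_mass_in_mass_def by (intro ballI conjI sub) auto
qed

lemma mu_norm_square:
  assumes "0 \<le> k" "0 \<le> \<kappa>" "0 \<le> \<mu>"
  shows "(mu_norm k \<kappa> \<mu> (a, b, c, d))\<^sup>2 =
    k / 2 * (norm a)\<^sup>2 + 1 / 2 * (norm b)\<^sup>2 + \<kappa> / 2 * (norm c)\<^sup>2 + \<mu> / 2 * (norm d)\<^sup>2"
  using assms by simp

lemma mu_norm_nonneg: "0 \<le> k \<Longrightarrow> 0 \<le> \<kappa> \<Longrightarrow> 0 \<le> \<mu> \<Longrightarrow> 0 \<le> mu_norm k \<kappa> \<mu> z"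
  by (cases z) simp

lemma norm_add_square_le: "(norm (x + y))\<^sup>2 \<le> 2 * (norm x)\<^sup>2 + 2 * (norm y)\<^sup>2"
proof -
  have "(norm (x + y))\<^sup>2 \<le> (norm x + norm y)\<^sup>2"
    by (intro power_mono norm_triangle_ineq) simp
  also have "\<dots> \<le> 2 * (norm x)\<^sup>2 + 2 * (norm y)\<^sup>2"
    using sum_squares_bound[of "norm x" "norm y"] by (simp add: power2_sum)
  finally show ?thesis .
qed

text \<open>
  Energy estimate for the errors \<open>a = R - R'\<close>, \<open>c = r - r'\<close>, \<open>e = p - p'\<close> and the corrected momentum
  error \<open>m = P - P' + \<mu> y\<close>, for as long as \<open>R\<close> and \<open>R'\<close> lie in the unit ball.  They satisfy
  \<open>da/dt = \<delta>\<^sup>+(m - \<mu> y)\<close>, \<open>dm/dt = \<Delta> + \<kappa> c\<close>, \<open>dc/dt = e - m + \<mu> y\<close> and \<open>\<mu> de/dt = - \<kappa> c\<close>.  In the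
  derivative of the energy the terms pairing \<open>c\<close> with \<open>m\<close> and \<open>c\<close> with \<open>e\<close> cancel, so nothing of
  size \<open>1/\<mu>\<close> or \<open>1/sqrt \<mu>\<close> survives, and every occurrence of \<open>y\<close> carries a factor \<open>\<mu>\<close>.
\<close>

lemma approximation_error:
  fixes V :: "real \<Rightarrow> real" and t \<mu> :: real
  defines "S \<equiv> closed_segment 0 t" and "k \<equiv> deriv (deriv V) 0"
  assumes V: "smooth V" "deriv V 0 = 0" "0 < k"
    and pos: "0 < \<kappa>" "0 < \<mu>" "\<mu> \<le> 1" and C1: "0 \<le> C1"
    and fput: "solves_FPUT V \<mu> S R' P'" and osc: "solves_driven_oscillator \<kappa> \<mu> P' S r' p'"
    and mim: "solves_mass_in_mass V \<kappa> \<mu> S R P r p"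
    and small: "\<And>s. s \<in> S \<Longrightarrow> norm (R' s) \<le> 1" "\<And>s. s \<in> S \<Longrightarrow> norm (R s) \<le> 1"
    and B: "1 \<le> B" "\<And>u. \<bar>u\<bar> \<le> 1 \<Longrightarrow> \<bar>deriv (deriv V) u\<bar> \<le> B"
    and slaved: "\<And>s. s \<in> S \<Longrightarrow> norm (p' s - P' s) \<le> C1 * \<mu>"
    and init: "mu_norm k \<kappa> \<mu> ((R 0, P 0, r 0, p 0) - (R' 0, P' 0, r' 0, p' 0)) \<le> K * \<mu>\<^sup>2"
    and T: "\<bar>t\<bar> \<le> T"
  shows "mu_norm k \<kappa> \<mu> ((R t, P t, r t, p t) - (R' t, P' t, r' t, p' t)) \<le>
    sqrt (2 * (2 * K\<^sup>2 + C1\<^sup>2 + (B + \<kappa> / 2) * C1\<^sup>2) * exp ((6 * B / k + 4 * B + 1) * T) + C1\<^sup>2) * \<mu>\<^sup>2"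
proof -
  note d = smooth_derivs[OF V(1)]
  define y where "y s = p' s - P' s" for s
  define a where "a s = R s - R' s" for s
  define m where "m s = P s - P' s + \<mu> *\<^sub>R y s" for s
  define c where "c s = r s - r' s" for s
  define e where "e s = p s - p' s" for s
  define \<Delta> where "\<Delta> s = delta_minus (map_entries (deriv V) (R s) - map_entries (deriv V) (R' s))" for s
  define G where "G s = k / 2 * (norm (a s))\<^sup>2 + 1 / 2 * (norm (m s))\<^sup>2
    + \<kappa> / 2 * (norm (c s))\<^sup>2 + \<mu> / 2 * (norm (e s))\<^sup>2" for s
  define A where "A = 6 * B / k + 4 * B + 1"
  define D where "D = (B + \<kappa> / 2) * C1\<^sup>2 * \<mu> ^ 4"
  have kB: "k \<le> B"
    using B(2)[of 0] by (simp add: k_def)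
  interpret dp: bounded_linear delta_plus by (rule bounded_linear_delta_plus)
  interpret dm: bounded_linear delta_minus by (rule bounded_linear_delta_minus)
  have a': "(a has_vector_derivative delta_plus (m s - \<mu> *\<^sub>R y s)) (at s within S)" if s: "s \<in> S" for s
    unfolding a_def[abs_def] m_def using fput mim s
    by (auto simp: solves_FPUT_def solves_mass_in_mass_def dp.diff intro!: derivative_eq_intros)
  have m': "(m has_vector_derivative \<Delta> s + \<kappa> *\<^sub>R c s) (at s within S)" if s: "s \<in> S" for s
  proof -
    have "(P has_vector_derivative delta_minus (map_entries (deriv V) (R s)) + \<kappa> *\<^sub>R r s) (at s within S)"
      using mim s by (auto simp: solves_mass_in_mass_def)
    moreover have "((\<lambda>s. (1 + \<mu>) *\<^sub>R P' s) has_vector_derivative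
        delta_minus (map_entries (deriv V) (R' s))) (at s within S)"
      using bounded_linear.has_vector_derivative[OF bounded_linear_scaleR_right, of P' _ "at s within S" "1 + \<mu>"]
        fput s pos by (fastforce simp: solves_FPUT_def)
    moreover have "((\<lambda>s. \<mu> *\<^sub>R p' s) has_vector_derivative - (\<kappa> *\<^sub>R r' s)) (at s within S)"
      using osc s by (auto simp: solves_driven_oscillator_def)
    ultimately have "((\<lambda>s. P s - (1 + \<mu>) *\<^sub>R P' s + \<mu> *\<^sub>R p' s) has_vector_derivative
        (delta_minus (map_entries (deriv V) (R s)) + \<kappa> *\<^sub>R r s)
        - delta_minus (map_entries (deriv V) (R' s)) + - (\<kappa> *\<^sub>R r' s)) (at s within S)"
      by (intro has_vector_derivative_add has_vector_derivative_diff)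
    \<comment> \<open>this rewriting of \<open>m\<close> makes the residual disappear\<close>
    moreover have "(\<lambda>s. P s - (1 + \<mu>) *\<^sub>R P' s + \<mu> *\<^sub>R p' s) = m"
      by (rule ext) (simp add: m_def y_def algebra_simps)
    ultimately show ?thesis
      by (simp add: \<Delta>_def c_def dm.diff algebra_simps)
  qed
  have c': "(c has_vector_derivative e s - m s + \<mu> *\<^sub>R y s) (at s within S)" if s: "s \<in> S" for s
    unfolding c_def[abs_def] e_def m_def using osc mim s
    by (auto simp: solves_driven_oscillator_def solves_mass_in_mass_def intro!: derivative_eq_intros)
  have e': "(e has_vector_derivative (1 / \<mu>) *\<^sub>R - (\<kappa> *\<^sub>R c s)) (at s within S)" if s: "s \<in> S" for s
  proof -
    have "((\<lambda>s. \<mu> *\<^sub>R p s) has_vector_derivative - (\<kappa> *\<^sub>R r s)) (at s within S)"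
      "((\<lambda>s. \<mu> *\<^sub>R p' s) has_vector_derivative - (\<kappa> *\<^sub>R r' s)) (at s within S)"
      using osc mim s by (auto simp: solves_driven_oscillator_def solves_mass_in_mass_def)
    from has_vector_derivative_diff[OF this]
    have "((\<lambda>s. \<mu> *\<^sub>R e s) has_vector_derivative - (\<kappa> *\<^sub>R c s)) (at s within S)"
      by (simp add: e_def c_def algebra_simps)
    then show ?thesis
      by (rule has_vector_derivative_unscale[OF _ pos(2)])
  qed
  have G': "(G has_real_derivative
      k * inner (a s) (delta_plus (m s - \<mu> *\<^sub>R y s)) + inner (m s) (\<Delta> s) + \<kappa> * \<mu> * inner (c s) (y s))
      (at s within S)" if s: "s \<in> S" for s
  proof -
    have "(G has_real_derivative
        k / 2 * (2 * inner (a s) (delta_plus (m s - \<mu> *\<^sub>R y s)))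
        + 1 / 2 * (2 * inner (m s) (\<Delta> s + \<kappa> *\<^sub>R c s))
        + \<kappa> / 2 * (2 * inner (c s) (e s - m s + \<mu> *\<^sub>R y s))
        + \<mu> / 2 * (2 * inner (e s) ((1 / \<mu>) *\<^sub>R - (\<kappa> *\<^sub>R c s)))) (at s within S)"
      unfolding G_def[abs_def]
      by (intro DERIV_add DERIV_cmult has_real_derivative_norm_square a' m' c' e' s)
    then show ?thesis
      by (rule DERIV_cong) (use pos in \<open>simp add: inner_add_right inner_diff_right
        inner_commute[of "c s" "m s"] inner_commute[of "e s" "c s"] algebra_simps\<close>)
  qed
  have bound: "\<bar>k * inner (a s) (delta_plus (m s - \<mu> *\<^sub>R y s)) + inner (m s) (\<Delta> s)
      + \<kappa> * \<mu> * inner (c s) (y s)\<bar> \<le> A * G s + D" if s: "s \<in> S" for s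
  proof -
    define x z w where "x = norm (a s)" and "z = norm (m s)" and "w = norm (c s)"
    have nn: "0 \<le> x" "0 \<le> z" "0 \<le> w"
      by (auto simp: x_def z_def w_def)
    have ys: "norm (y s) \<le> C1 * \<mu>"
      using slaved[OF s] by (simp add: y_def)
    have "norm (delta_plus (m s - \<mu> *\<^sub>R y s)) \<le> 2 * (z + \<mu> * (C1 * \<mu>))"
    proof -
      have "norm (m s - \<mu> *\<^sub>R y s) \<le> z + \<mu> * norm (y s)"
        using norm_triangle_ineq4[of "m s" "\<mu> *\<^sub>R y s"] pos by (simp add: z_def)
      also have "\<dots> \<le> z + \<mu> * (C1 * \<mu>)"
        using ys pos by simp
      finally show ?thesis
        by (intro order_trans[OF norm_delta_plus_le] mult_left_mono) simp_all
    qed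
    then have "\<bar>inner (a s) (delta_plus (m s - \<mu> *\<^sub>R y s))\<bar> \<le> x * (2 * (z + \<mu> * (C1 * \<mu>)))"
      unfolding x_def by (intro order_trans[OF Cauchy_Schwarz_ineq2] mult_left_mono) auto
    then have "\<bar>k * inner (a s) (delta_plus (m s - \<mu> *\<^sub>R y s))\<bar> \<le> B * (x * (2 * (z + \<mu> * (C1 * \<mu>))))"
      unfolding abs_mult using V(3) kB B(1) by (intro mult_mono) auto
    moreover have "\<bar>inner (m s) (\<Delta> s)\<bar> \<le> z * (2 * (B * x))"
    proof -
      have "norm (map_entries (deriv V) (R s) - map_entries (deriv V) (R' s)) \<le> B * norm (R s - R' s)"
        by (rule norm_map_entries_diff_le[OF d(2,5) V(2) B(2)]) (use small[OF s] in auto)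
      then have "norm (\<Delta> s) \<le> 2 * (B * x)"
        unfolding \<Delta>_def x_def a_def by (intro order_trans[OF norm_delta_minus_le] mult_left_mono) simp_all
      then show ?thesis
        unfolding z_def by (intro order_trans[OF Cauchy_Schwarz_ineq2] mult_left_mono) auto
    qed
    moreover have "\<bar>\<kappa> * \<mu> * inner (c s) (y s)\<bar> \<le> \<kappa> * \<mu> * (w * (C1 * \<mu>))"
    proof -
      have "\<bar>inner (c s) (y s)\<bar> \<le> w * (C1 * \<mu>)"
        unfolding w_def using ys by (intro order_trans[OF Cauchy_Schwarz_ineq2] mult_left_mono) auto
      then show ?thesis
        using pos by (simp add: abs_mult mult_left_mono)
    qed
    ultimately have "\<bar>k * inner (a s) (delta_plus (m s - \<mu> *\<^sub>R y s)) + inner (m s) (\<Delta> s)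
        + \<kappa> * \<mu> * inner (c s) (y s)\<bar>
        \<le> B * (x * (2 * (z + \<mu> * (C1 * \<mu>)))) + z * (2 * (B * x)) + \<kappa> * \<mu> * (w * (C1 * \<mu>))"
      by linarith
    also have "\<dots> = 4 * B * (x * z) + 2 * B * (x * (C1 * \<mu>\<^sup>2)) + \<kappa> * (w * (C1 * \<mu>\<^sup>2))"
      by (simp add: algebra_simps power2_eq_square)
    also have "\<dots> \<le> (2 * B * x\<^sup>2 + 2 * B * z\<^sup>2) + (B * x\<^sup>2 + B * (C1 * \<mu>\<^sup>2)\<^sup>2)
        + (\<kappa> / 2 * w\<^sup>2 + \<kappa> / 2 * (C1 * \<mu>\<^sup>2)\<^sup>2)"
    proof (intro add_mono)
      show "4 * B * (x * z) \<le> 2 * B * x\<^sup>2 + 2 * B * z\<^sup>2"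
        using mult_left_mono[OF sum_squares_bound[of x z], of "2 * B"] B(1) by (simp add: algebra_simps)
      show "2 * B * (x * (C1 * \<mu>\<^sup>2)) \<le> B * x\<^sup>2 + B * (C1 * \<mu>\<^sup>2)\<^sup>2"
        using mult_left_mono[OF sum_squares_bound[of x "C1 * \<mu>\<^sup>2"], of B] B(1) by (simp add: algebra_simps)
      show "\<kappa> * (w * (C1 * \<mu>\<^sup>2)) \<le> \<kappa> / 2 * w\<^sup>2 + \<kappa> / 2 * (C1 * \<mu>\<^sup>2)\<^sup>2"
        using mult_left_mono[OF sum_squares_bound[of w "C1 * \<mu>\<^sup>2"], of "\<kappa> / 2"] pos by (simp add: algebra_simps)
    qed
    also have "\<dots> = 6 * B / k * (k / 2 * x\<^sup>2) + 4 * B * (1 / 2 * z\<^sup>2) + 1 * (\<kappa> / 2 * w\<^sup>2) + D"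
      using V(3) by (simp add: D_def power_mult_distrib algebra_simps)
    also have "\<dots> \<le> A * (k / 2 * x\<^sup>2) + A * (1 / 2 * z\<^sup>2) + A * (\<kappa> / 2 * w\<^sup>2) + D"
      using V(3) B(1) pos unfolding A_def
      by (intro add_mono mult_right_mono order_refl) (auto intro: divide_nonneg_nonneg)
    also have "\<dots> \<le> A * G s + D"
      using V(3) B(1) pos unfolding G_def x_def z_def w_def distrib_left
      by (auto simp: A_def intro!: mult_nonneg_nonneg add_nonneg_nonneg)
    finally show ?thesis .
  qed
  have zero: "0 \<in> S" "t \<in> S"
    by (auto simp: S_def)
  have A1: "1 \<le> A"
    using V(3) B(1) by (simp add: A_def)
  have D0: "0 \<le> D"
    using B(1) pos by (simp add: D_def)
  have "G t \<le> (G 0 + D) * exp (A * \<bar>t\<bar>)"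
    by (rule gronwall_two_sided[OF G'[unfolded S_def] bound[unfolded S_def] A1 D0])
  have y4: "\<mu>\<^sup>2 * (norm (y s))\<^sup>2 \<le> C1\<^sup>2 * \<mu> ^ 4" if "s \<in> S" for s
  proof -
    have "(\<mu> * norm (y s))\<^sup>2 \<le> (\<mu> * (C1 * \<mu>))\<^sup>2"
      using slaved[OF that] pos by (intro power_mono mult_left_mono) (auto simp: y_def)
    then show ?thesis
      by (simp add: power_mult_distrib algebra_simps power_numeral_reduce)
  qed
  have G0: "G 0 \<le> (2 * K\<^sup>2 + C1\<^sup>2) * \<mu> ^ 4"
  proof -
    have "(mu_norm k \<kappa> \<mu> ((R 0, P 0, r 0, p 0) - (R' 0, P' 0, r' 0, p' 0)))\<^sup>2 \<le> (K * \<mu>\<^sup>2)\<^sup>2"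
      using init V(3) pos by (intro power_mono mu_norm_nonneg) auto
    also have "\<dots> = K\<^sup>2 * \<mu> ^ 4"
      by (simp add: power_mult_distrib)
    finally have "k / 2 * (norm (a 0))\<^sup>2 + 1 / 2 * (norm (P 0 - P' 0))\<^sup>2
        + \<kappa> / 2 * (norm (c 0))\<^sup>2 + \<mu> / 2 * (norm (e 0))\<^sup>2 \<le> K\<^sup>2 * \<mu> ^ 4"
      using V(3) pos mu_norm_square[of k \<kappa> \<mu> "R 0 - R' 0"] by (simp only: a_def c_def e_def minus_prod_def fst_conv snd_conv less_imp_le)
    moreover have "(norm (m 0))\<^sup>2 \<le> 2 * (norm (P 0 - P' 0))\<^sup>2 + 2 * (C1\<^sup>2 * \<mu> ^ 4)"
      using norm_add_square_le[of "P 0 - P' 0" "\<mu> *\<^sub>R y 0"] y4[OF zero(1)]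
      by (simp add: m_def power_mult_distrib)
    moreover have "0 \<le> k / 2 * (norm (a 0))\<^sup>2" "0 \<le> \<kappa> / 2 * (norm (c 0))\<^sup>2" "0 \<le> \<mu> / 2 * (norm (e 0))\<^sup>2"
      using V(3) pos by auto
    ultimately show ?thesis
      unfolding G_def distrib_right by linarith
  qed
  have "G t \<le> ((2 * K\<^sup>2 + C1\<^sup>2) * \<mu> ^ 4 + D) * exp (A * T)"
  proof -
    have "G t \<le> (G 0 + D) * exp (A * \<bar>t\<bar>)" by fact
    also have "\<dots> \<le> ((2 * K\<^sup>2 + C1\<^sup>2) * \<mu> ^ 4 + D) * exp (A * T)"
      using G0 D0 T A1 pos by (intro mult_mono add_mono) (auto intro!: add_nonneg_nonneg)
    finally show ?thesis .
  qed
  then have Gt: "G t \<le> (2 * K\<^sup>2 + C1\<^sup>2 + (B + \<kappa> / 2) * C1\<^sup>2) * exp (A * T) * \<mu> ^ 4"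
    by (simp add: D_def algebra_simps)
  have "(mu_norm k \<kappa> \<mu> ((R t, P t, r t, p t) - (R' t, P' t, r' t, p' t)))\<^sup>2
      = k / 2 * (norm (a t))\<^sup>2 + 1 / 2 * (norm (P t - P' t))\<^sup>2
        + \<kappa> / 2 * (norm (c t))\<^sup>2 + \<mu> / 2 * (norm (e t))\<^sup>2"
    using V(3) pos mu_norm_square[of k \<kappa> \<mu> "R t - R' t"] by (simp only: a_def c_def e_def minus_prod_def fst_conv snd_conv less_imp_le)
  also have "\<dots> \<le> 2 * G t + C1\<^sup>2 * \<mu> ^ 4"
  proof -
    have arith: "x + 1 / 2 * u + y + z \<le> 2 * (x + 1 / 2 * v + y + z) + w"
      if "u \<le> 2 * v + 2 * w" "0 \<le> x" "0 \<le> y" "0 \<le> z" for x y z u v w :: real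
      using that by (simp add: algebra_simps)
    have "(norm (P t - P' t))\<^sup>2 \<le> 2 * (norm (m t))\<^sup>2 + 2 * (C1\<^sup>2 * \<mu> ^ 4)"
      using norm_add_square_le[of "m t" "- (\<mu> *\<^sub>R y t)"] y4[OF zero(2)]
      by (simp add: m_def power_mult_distrib)
    moreover have "0 \<le> k / 2 * (norm (a t))\<^sup>2" "0 \<le> \<kappa> / 2 * (norm (c t))\<^sup>2" "0 \<le> \<mu> / 2 * (norm (e t))\<^sup>2"
      using V(3) pos by auto
    ultimately show ?thesis
      unfolding G_def by (rule arith)
  qed
  also have "\<dots> \<le> (2 * (2 * K\<^sup>2 + C1\<^sup>2 + (B + \<kappa> / 2) * C1\<^sup>2) * exp (A * T) + C1\<^sup>2) * \<mu> ^ 4"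
    using Gt by (simp add: algebra_simps)
  finally have "mu_norm k \<kappa> \<mu> ((R t, P t, r t, p t) - (R' t, P' t, r' t, p' t))
      \<le> sqrt ((2 * (2 * K\<^sup>2 + C1\<^sup>2 + (B + \<kappa> / 2) * C1\<^sup>2) * exp (A * T) + C1\<^sup>2) * \<mu> ^ 4)"
    by (rule real_le_rsqrt)
  also have "\<dots> = sqrt (2 * (2 * K\<^sup>2 + C1\<^sup>2 + (B + \<kappa> / 2) * C1\<^sup>2) * exp (A * T) + C1\<^sup>2) * \<mu>\<^sup>2"
    by (simp add: real_sqrt_mult real_sqrt_abs[of "\<mu>\<^sup>2", simplified])
  finally show ?thesis
    by (simp only: A_def)
qed


section \<open>The effective FPUT lattice\<close>

text \<open>
  The hypothesis on the initial data is phrased with \<open>\<delta>\<^sup>-V'(R)\<close> and its time derivative, whereas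
  the first two derivatives of \<open>P\<close> are these divided by \<open>1 + \<mu>\<close>.  As \<open>1 - 1/(1 + \<mu>) \<le> \<mu>\<close> and both enter with a factor \<open>\<mu>/\<kappa>\<close>, the
  difference is again \<open>O(\<mu>\<^sup>2)\<close>.
\<close>

lemma FPUT_driven_oscillator_slaved:
  fixes V :: "real \<Rightarrow> real" and \<kappa> K T B :: real
  assumes V: "smooth V" "deriv V 0 = 0" and "0 < \<kappa>" "0 < K"
    and B: "1 \<le> B" "\<And>u. \<bar>u\<bar> \<le> 1 \<Longrightarrow> \<bar>deriv (deriv V) u\<bar> \<le> B"
      "\<And>u. \<bar>u\<bar> \<le> 1 \<Longrightarrow> \<bar>deriv (deriv (deriv V)) u\<bar> \<le> B"
  obtains C where "0 \<le> C"
    "\<And>\<mu> t R P r p. \<lbrakk>0 < \<mu>; \<mu> \<le> 1; \<bar>t\<bar> \<le> T;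
      solves_FPUT V \<mu> (closed_segment 0 t) R P;
      solves_driven_oscillator \<kappa> \<mu> P (closed_segment 0 t) r p;
      \<And>s. s \<in> closed_segment 0 t \<Longrightarrow> norm (R s) \<le> 1 \<and> norm (P s) \<le> 1;
      norm (r 0 + (\<mu> / \<kappa>) *\<^sub>R delta_minus (map_entries (deriv V) (R 0)))
        + sqrt \<mu> * norm (p 0 - P 0
            + (\<mu> / \<kappa>) *\<^sub>R delta_minus (weight_entries (deriv (deriv V)) (R 0) (delta_plus (P 0))))
        \<le> K * \<mu>\<^sup>2\<rbrakk> \<Longrightarrow> norm (p t - P t) \<le> C * \<mu>"
proof -
  define M where "M = 16 * B\<^sup>2"
  define N where "N = K + M / \<kappa>"
  define C where "C = sqrt (((\<kappa> + 1) * N\<^sup>2 + M\<^sup>2 / \<kappa>\<^sup>2) * exp T) + M / \<kappa>"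
  have M: "0 \<le> M"
    by (simp add: M_def)
  show ?thesis
  proof (rule that[of C])
    show "0 \<le> C"
      using M \<open>0 < \<kappa>\<close> by (simp add: C_def)
    fix \<mu> t :: real and R P r p :: "real \<Rightarrow> l2"
    let ?S = "closed_segment 0 t"
    let ?F = "\<lambda>s. delta_minus (map_entries (deriv V) (R s))"
    let ?F1 = "\<lambda>s. delta_minus (weight_entries (deriv (deriv V)) (R s) (delta_plus (P s)))"
    assume \<mu>: "0 < \<mu>" "\<mu> \<le> 1" and t: "\<bar>t\<bar> \<le> T" and fput: "solves_FPUT V \<mu> ?S R P"
      and osc: "solves_driven_oscillator \<kappa> \<mu> P ?S r p"
      and small: "\<And>s. s \<in> ?S \<Longrightarrow> norm (R s) \<le> 1 \<and> norm (P s) \<le> 1"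
      and init: "norm (r 0 + (\<mu> / \<kappa>) *\<^sub>R ?F 0) + sqrt \<mu> * norm (p 0 - P 0 + (\<mu> / \<kappa>) *\<^sub>R ?F1 0)
        \<le> K * \<mu>\<^sup>2"
    define a where "a = 1 / (1 + \<mu>)"
    have a: "0 \<le> a" "\<bar>a\<bar> \<le> 1" "\<bar>1 - a\<bar> \<le> \<mu>"
      using \<mu> by (auto simp: a_def field_simps)
    have R: "(R has_vector_derivative delta_plus (P s)) (at s within ?S)"
      and P: "(P has_vector_derivative a *\<^sub>R ?F s) (at s within ?S)" if "s \<in> ?S" for s
      using fput that by (auto simp: solves_FPUT_def a_def)
    obtain F2 where F2: "\<And>s. s \<in> ?S \<Longrightarrow> (?F has_vector_derivative ?F1 s) (at s within ?S)"
      "\<And>s. s \<in> ?S \<Longrightarrow> (?F1 has_vector_derivative F2 s) (at s within ?S)"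
      "\<And>s. s \<in> ?S \<Longrightarrow> norm (?F s) \<le> M" "\<And>s. s \<in> ?S \<Longrightarrow> norm (?F1 s) \<le> M"
      "\<And>s. s \<in> ?S \<Longrightarrow> norm (F2 s) \<le> M"
    proof (rule FPUT_third_derivative[OF V R P a(2) _ _ B])
      show "norm (R s) \<le> 1" "norm (P s) \<le> 1" if "s \<in> ?S" for s
        using small[OF that] by auto
    qed (assumption+, rule that, simp_all add: M_def)
    have scale: "norm (a *\<^sub>R x) \<le> M" if "norm x \<le> M" for x :: l2
      using a(2) that mult_mono[of "\<bar>a\<bar>" 1 "norm x" M] by simp
    have shift_init: "norm (x + (\<mu> / \<kappa>) *\<^sub>R a *\<^sub>R z) \<le> norm (x + (\<mu> / \<kappa>) *\<^sub>R z) + M / \<kappa> * \<mu>\<^sup>2"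
      if z: "norm z \<le> M" for x z :: l2
    proof -
      have "x + (\<mu> / \<kappa>) *\<^sub>R a *\<^sub>R z = (x + (\<mu> / \<kappa>) *\<^sub>R z) - (\<mu> / \<kappa> * (1 - a)) *\<^sub>R z"
        by (simp add: right_diff_distrib scaleR_diff_left)
      then have "norm (x + (\<mu> / \<kappa>) *\<^sub>R a *\<^sub>R z) \<le> norm (x + (\<mu> / \<kappa>) *\<^sub>R z) + norm ((\<mu> / \<kappa> * (1 - a)) *\<^sub>R z)"
        by (simp only: norm_triangle_ineq4)
      also have "norm ((\<mu> / \<kappa> * (1 - a)) *\<^sub>R z) = \<mu> / \<kappa> * \<bar>1 - a\<bar> * norm z"
        using \<mu> \<open>0 < \<kappa>\<close> by (simp add: abs_mult)
      also have "\<dots> \<le> \<mu> / \<kappa> * \<mu> * M"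
        using \<mu> \<open>0 < \<kappa>\<close> a z M by (intro mult_mono) auto
      also have "\<dots> = M / \<kappa> * \<mu>\<^sup>2"
        by (simp add: power2_eq_square)
      finally show ?thesis by simp
    qed
    have zero: "0 \<in> ?S"
      by simp
    have init1: "norm (r 0 + (\<mu> / \<kappa>) *\<^sub>R ?F 0) \<le> K * \<mu>\<^sup>2"
      and init2: "sqrt \<mu> * norm (p 0 - P 0 + (\<mu> / \<kappa>) *\<^sub>R ?F1 0) \<le> K * \<mu>\<^sup>2"
      using init \<mu> mult_nonneg_nonneg[OF real_sqrt_ge_zero[of \<mu>] norm_ge_zero[of "p 0 - P 0 + (\<mu> / \<kappa>) *\<^sub>R ?F1 0"]]
        norm_ge_zero[of "r 0 + (\<mu> / \<kappa>) *\<^sub>R ?F 0"] by linarith+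
    show "norm (p t - P t) \<le> C * \<mu>"
      unfolding C_def
    proof (rule driven_oscillator_follows_drive[where r = r and ?A0.0 = "\<lambda>s. a *\<^sub>R ?F s"
          and ?A1.0 = "\<lambda>s. a *\<^sub>R ?F1 s" and ?A2.0 = "\<lambda>s. a *\<^sub>R F2 s"])
      show "(r has_vector_derivative p s - P s) (at s within ?S)"
        "((\<lambda>s. \<mu> *\<^sub>R p s) has_vector_derivative - (\<kappa> *\<^sub>R r s)) (at s within ?S)" if "s \<in> ?S" for s
        using osc that by (auto simp: solves_driven_oscillator_def)
      show "((\<lambda>s. a *\<^sub>R ?F s) has_vector_derivative a *\<^sub>R ?F1 s) (at s within ?S)"
        "((\<lambda>s. a *\<^sub>R ?F1 s) has_vector_derivative a *\<^sub>R F2 s) (at s within ?S)" if "s \<in> ?S" for s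
        using F2(1,2)[OF that]
        by (auto intro: bounded_linear.has_vector_derivative[OF bounded_linear_scaleR_right])
      show "norm (a *\<^sub>R ?F1 s) \<le> M" "norm (a *\<^sub>R F2 s) \<le> M" if "s \<in> ?S" for s
        by (intro scale F2 that)+
      show "norm (r 0 + (\<mu> / \<kappa>) *\<^sub>R a *\<^sub>R ?F 0) \<le> N * \<mu>\<^sup>2"
        using shift_init[OF F2(3)[OF zero], of "r 0"] init1 by (simp add: N_def distrib_right)
      have "sqrt \<mu> * norm (p 0 - P 0 + (\<mu> / \<kappa>) *\<^sub>R a *\<^sub>R ?F1 0)
          \<le> sqrt \<mu> * (norm (p 0 - P 0 + (\<mu> / \<kappa>) *\<^sub>R ?F1 0) + M / \<kappa> * \<mu>\<^sup>2)"
        using \<mu> by (intro mult_left_mono shift_init F2(4) zero) auto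
      also have "\<dots> \<le> K * \<mu>\<^sup>2 + 1 * (M / \<kappa> * \<mu>\<^sup>2)"
        unfolding distrib_left using \<mu> M \<open>0 < \<kappa>\<close> by (intro add_mono init2 mult_right_mono) auto
      finally show "sqrt \<mu> * norm (p 0 - P 0 + (\<mu> / \<kappa>) *\<^sub>R a *\<^sub>R ?F1 0) \<le> N * \<mu>\<^sup>2"
        by (simp add: N_def distrib_right)
    qed (use P \<open>0 < \<kappa>\<close> \<mu> t in auto)
  qed
qed

theorem corollary6:
  fixes V :: "real \<Rightarrow> real"
  assumes "smooth V" and "V 0 = 0" and "deriv V 0 = 0" and "deriv (deriv V) 0 > 0"
  shows "\<exists>\<rho>\<^sub>s>0. \<forall>\<kappa>>0. \<forall>K\<^sub>s>0. \<forall>T\<^sub>s>0. \<exists>\<mu>\<^sub>s>0. \<exists>C\<^sub>s>0. \<forall>\<mu>. 0 < \<mu> \<and> \<mu> \<le> \<mu>\<^sub>s \<longrightarrow>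
    (\<forall>(J :: real set) (R' :: real \<Rightarrow> l2) P' r' p' R P r p.
      is_interval J \<and> 0 \<in> J \<and>
      solves_FPUT V \<mu> J R' P' \<and>
      norm (R' 0) + norm (P' 0) \<le> \<rho>\<^sub>s \<and>
      solves_driven_oscillator \<kappa> \<mu> P' J r' p' \<and>
      norm (r' 0 + (\<mu> / \<kappa>) *\<^sub>R delta_minus (map_entries (deriv V) (R' 0)))
        + sqrt \<mu> * norm (p' 0 - P' 0
            + (\<mu> / \<kappa>) *\<^sub>R delta_minus (weight_entries (deriv (deriv V)) (R' 0) (delta_plus (P' 0))))
        \<le> K\<^sub>s * \<mu>\<^sup>2 \<and>
      solves_mass_in_mass V \<kappa> \<mu> J R P r p \<and>
      mu_norm (deriv (deriv V) 0) \<kappa> \<mu> ((R 0, P 0, r 0, p 0) - (R' 0, P' 0, r' 0, p' 0))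
        \<le> K\<^sub>s * \<mu>\<^sup>2
      \<longrightarrow> (\<forall>t \<in> J \<inter> {- T\<^sub>s..T\<^sub>s}.
            mu_norm (deriv (deriv V) 0) \<kappa> \<mu> ((R t, P t, r t, p t) - (R' t, P' t, r' t, p' t))
              \<le> C\<^sub>s * \<mu>\<^sup>2))"
proof -
  note V = assms
  define k where "k = deriv (deriv V) 0"
  have k: "0 < k"
    using V by (simp add: k_def)
  obtain B2 B3 where B2: "1 \<le> B2" "\<And>u. \<bar>u\<bar> \<le> 1 \<Longrightarrow> \<bar>deriv (deriv V) u\<bar> \<le> B2"
    and B3: "1 \<le> B3" "\<And>u. \<bar>u\<bar> \<le> 1 \<Longrightarrow> \<bar>deriv (deriv (deriv V)) u\<bar> \<le> B3"
    using bounded_on_compact_interval[OF smooth_derivs(5)[OF V(1)], of 1]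
      bounded_on_compact_interval[OF smooth_derivs(6)[OF V(1)], of 1] by metis
  define B where "B = max B2 B3"
  have B: "1 \<le> B" "\<And>u. \<bar>u\<bar> \<le> 1 \<Longrightarrow> \<bar>deriv (deriv V) u\<bar> \<le> B"
    "\<And>u. \<bar>u\<bar> \<le> 1 \<Longrightarrow> \<bar>deriv (deriv (deriv V)) u\<bar> \<le> B"
    using B2 B3 by (auto simp: B_def intro: max.coboundedI1 max.coboundedI2)
  obtain \<rho> where \<rho>: "\<rho> > 0"
    "\<And>\<mu> J R P t. \<lbrakk>0 < \<mu>; \<mu> \<le> 1; is_interval J; 0 \<in> J; t \<in> J; solves_FPUT V \<mu> J R P;
      norm (R 0) + norm (P 0) \<le> \<rho>\<rbrakk> \<Longrightarrow> norm (R t) \<le> 1 / 2 \<and> norm (P t) \<le> 1 / 2"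
    using FPUT_stability[OF V, of "1 / 2"] by auto
  show ?thesis
    unfolding k_def[symmetric]
  proof (rule exI[of _ \<rho>], intro conjI \<rho>(1) allI impI)
    fix \<kappa> K T :: real
    assume \<kappa>: "0 < \<kappa>" and K: "0 < K" and T: "0 < T"
    obtain C1 where C1: "0 \<le> C1"
      "\<And>\<mu> t R P r p. \<lbrakk>0 < \<mu>; \<mu> \<le> 1; \<bar>t\<bar> \<le> T;
        solves_FPUT V \<mu> (closed_segment 0 t) R P;
        solves_driven_oscillator \<kappa> \<mu> P (closed_segment 0 t) r p;
        \<And>s. s \<in> closed_segment 0 t \<Longrightarrow> norm (R s) \<le> 1 \<and> norm (P s) \<le> 1;
        norm (r 0 + (\<mu> / \<kappa>) *\<^sub>R delta_minus (map_entries (deriv V) (R 0)))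
          + sqrt \<mu> * norm (p 0 - P 0
              + (\<mu> / \<kappa>) *\<^sub>R delta_minus (weight_entries (deriv (deriv V)) (R 0) (delta_plus (P 0))))
          \<le> K * \<mu>\<^sup>2\<rbrakk> \<Longrightarrow> norm (p t - P t) \<le> C1 * \<mu>"
      using FPUT_driven_oscillator_slaved[OF V(1,3) \<kappa> K B, of T] by blast
    define C0 where "C0 = sqrt (2 * (2 * K\<^sup>2 + C1\<^sup>2 + (B + \<kappa> / 2) * C1\<^sup>2)
      * exp ((6 * B / k + 4 * B + 1) * T) + C1\<^sup>2)"
    \<comment> \<open>adding \<open>K\<close> makes \<open>C \<mu>\<^sup>2\<close> dominate the initial error, which starts the continuation argument\<close>
    define C where "C = C0 + K"
    have C0: "0 \<le> C0"
      using B(1) \<kappa> by (simp add: C0_def)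
    have C: "0 < C" "C0 \<le> C" "K \<le> C"
      using C0 K by (auto simp: C_def)
    \<comment> \<open>an error of \<open>C \<mu>\<^sup>2\<close> in the energy norm bounds \<open>\<parallel>R - R'\<parallel>\<close> by \<open>L \<mu>\<^sup>2\<close>, and \<open>\<mu>s\<close> makes this
      less than \<open>1/2\<close>\<close>
    define L where "L = sqrt (2 / k) * C"
    have L: "0 < L"
      using C(1) k by (simp add: L_def)
    define \<mu>s where "\<mu>s = min 1 (1 / (4 * L))"
    have \<mu>s: "0 < \<mu>s"
      using L by (simp add: \<mu>s_def)
    show "\<exists>\<mu>\<^sub>s>0. \<exists>C\<^sub>s>0. \<forall>\<mu>. 0 < \<mu> \<and> \<mu> \<le> \<mu>\<^sub>s \<longrightarrow>
    (\<forall>(J :: real set) (R' :: real \<Rightarrow> l2) P' r' p' R P r p.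
      is_interval J \<and> 0 \<in> J \<and>
      solves_FPUT V \<mu> J R' P' \<and>
      norm (R' 0) + norm (P' 0) \<le> \<rho> \<and>
      solves_driven_oscillator \<kappa> \<mu> P' J r' p' \<and>
      norm (r' 0 + (\<mu> / \<kappa>) *\<^sub>R delta_minus (map_entries (deriv V) (R' 0)))
        + sqrt \<mu> * norm (p' 0 - P' 0
            + (\<mu> / \<kappa>) *\<^sub>R delta_minus (weight_entries (deriv (deriv V)) (R' 0) (delta_plus (P' 0))))
        \<le> K * \<mu>\<^sup>2 \<and>
      solves_mass_in_mass V \<kappa> \<mu> J R P r p \<and>
      mu_norm k \<kappa> \<mu> ((R 0, P 0, r 0, p 0) - (R' 0, P' 0, r' 0, p' 0)) \<le> K * \<mu>\<^sup>2
      \<longrightarrow> (\<forall>t \<in> J \<inter> {- T..T}.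
            mu_norm k \<kappa> \<mu> ((R t, P t, r t, p t) - (R' t, P' t, r' t, p' t)) \<le> C\<^sub>s * \<mu>\<^sup>2))"
    proof (rule exI[of _ \<mu>s], rule conjI, rule \<mu>s, rule exI[of _ C], rule conjI, rule C(1),
        intro allI impI ballI, elim conjE)
      fix \<mu> t :: real and J :: "real set" and R' P' r' p' R P r p :: "real \<Rightarrow> l2"
      assume \<mu>: "0 < \<mu>" "\<mu> \<le> \<mu>s" and J: "is_interval J" "0 \<in> J"
        and fput: "solves_FPUT V \<mu> J R' P'" and init: "norm (R' 0) + norm (P' 0) \<le> \<rho>"
        and osc: "solves_driven_oscillator \<kappa> \<mu> P' J r' p'"
        and init_osc: "norm (r' 0 + (\<mu> / \<kappa>) *\<^sub>R delta_minus (map_entries (deriv V) (R' 0)))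
          + sqrt \<mu> * norm (p' 0 - P' 0
            + (\<mu> / \<kappa>) *\<^sub>R delta_minus (weight_entries (deriv (deriv V)) (R' 0) (delta_plus (P' 0))))
          \<le> K * \<mu>\<^sup>2"
        and mim: "solves_mass_in_mass V \<kappa> \<mu> J R P r p"
        and init_mim: "mu_norm k \<kappa> \<mu> ((R 0, P 0, r 0, p 0) - (R' 0, P' 0, r' 0, p' 0)) \<le> K * \<mu>\<^sup>2"
        and t: "t \<in> J \<inter> {- T..T}"
      let ?J = "J \<inter> {- T..T}"
      let ?err = "\<lambda>s. mu_norm k \<kappa> \<mu> ((R s, P s, r s, p s) - (R' s, P' s, r' s, p' s))"
      have \<mu>1: "\<mu> \<le> 1" and L\<mu>: "L * \<mu> < 1 / 2"
        using \<mu> L by (auto simp: \<mu>s_def field_simps)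
      have J': "is_interval ?J" "0 \<in> ?J"
        using J T by (auto intro: is_interval_Int is_interval_cc)
      have seg: "closed_segment 0 s \<subseteq> ?J" if "s \<in> ?J" for s
        using closed_segment_subset[OF J'(2) that] is_interval_convex[OF J'(1)] by blast
      have small: "norm (R' s) \<le> 1 / 2" "norm (P' s) \<le> 1 / 2" if "s \<in> ?J" for s
        using \<rho>(2)[OF \<mu>(1) \<mu>1 J _ fput init] that by auto
      have slaved: "norm (p' s - P' s) \<le> C1 * \<mu>" if s: "s \<in> ?J" for s
      proof (rule C1(2)[where R = R' and P = P' and r = r' and p = p', OF \<mu>(1) \<mu>1 _ _ _ _ init_osc])
        have "closed_segment 0 s \<subseteq> J"
          using seg[OF s] by blast
        note sub = solves_subset[OF this]
        show "solves_FPUT V \<mu> (closed_segment 0 s) R' P'"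
          by (rule sub(1)[OF fput])
        show "solves_driven_oscillator \<kappa> \<mu> P' (closed_segment 0 s) r' p'"
          by (rule sub(2)[OF osc])
        show "norm (R' u) \<le> 1 \<and> norm (P' u) \<le> 1" if "u \<in> closed_segment 0 s" for u
        proof -
          have "u \<in> ?J"
            using seg[OF s] that by blast
          from small[OF this] show ?thesis
            by simp
        qed
      qed (use s in auto)
      have error: "?err s \<le> C * \<mu>\<^sup>2"
        if s: "s \<in> ?J" and R: "\<And>u. u \<in> closed_segment 0 s \<Longrightarrow> norm (R u) \<le> 1" for s
      proof -
        have "closed_segment 0 s \<subseteq> J"
          using seg[OF s] by blast
        note sub = solves_subset[OF this]
        have "?err s \<le> C0 * \<mu>\<^sup>2"
          unfolding C0_def k_def
        proof (rule approximation_error[where R = R and R' = R' and P = P and P' = P'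
              and r = r and r' = r' and p = p and p' = p', OF V(1,3) V(4) \<kappa> \<mu>(1) \<mu>1 C1(1) sub(1)[OF fput]
              sub(2)[OF osc] sub(3)[OF mim] _ R B(1,2)])
          show "norm (R' u) \<le> 1" "norm (p' u - P' u) \<le> C1 * \<mu>" if "u \<in> closed_segment 0 s" for u
          proof -
            have "u \<in> ?J"
              using seg[OF s] that by blast
            from small(1)[OF this] slaved[OF this]
            show "norm (R' u) \<le> 1" "norm (p' u - P' u) \<le> C1 * \<mu>"
              by simp_all
          qed
        qed (use s init_mim in \<open>auto simp: k_def\<close>)
        also have "\<dots> \<le> C * \<mu>\<^sup>2"
          using C(2) by (intro mult_right_mono) auto
        finally show ?thesis .
      qed
      have close: "norm (R s - R' s) < 1 / 2" if "?err s \<le> C * \<mu>\<^sup>2" for s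
      proof -
        have "k / 2 * (norm (R s - R' s))\<^sup>2 \<le> (?err s)\<^sup>2"
          using k \<kappa> \<mu>(1) by simp
        also have "\<dots> \<le> (C * \<mu>\<^sup>2)\<^sup>2"
          using that k \<kappa> \<mu>(1) by (intro power_mono mu_norm_nonneg) auto
        finally have "(norm (R s - R' s))\<^sup>2 \<le> 2 / k * (C * \<mu>\<^sup>2)\<^sup>2"
          using k by (simp add: field_simps)
        also have "\<dots> = (L * \<mu>\<^sup>2)\<^sup>2"
          using k by (simp add: L_def power_mult_distrib)
        finally have "norm (R s - R' s) \<le> L * \<mu>\<^sup>2"
          by (rule power2_le_imp_le) (use L in simp)
        also have "\<dots> \<le> L * \<mu>"
          using L \<mu>(1) \<mu>1 by (simp add: power2_eq_square mult_left_le)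
        finally show ?thesis
          using L\<mu> by simp
      qed
      have R_lt: "norm (R s) < 1" if "s \<in> ?J" "?err s \<le> C * \<mu>\<^sup>2" for s
        using close[OF that(2)] small(1)[OF that(1)] norm_triangle_ineq2[of "R s" "R' s"] by linarith
      have R_bound: "norm (R s) < 1" if s: "s \<in> ?J" for s
      proof (rule continuation_bound[OF J' s, of "\<lambda>s. norm (R s)"])
        have "continuous_on J R"
          using mim unfolding solves_mass_in_mass_def
          by (auto simp: continuous_on_eq_continuous_within intro: has_vector_derivative_continuous)
        then show "continuous_on ?J (\<lambda>s. norm (R s))"
          by (intro continuous_on_norm) (auto intro: continuous_on_subset)
        have "K * \<mu>\<^sup>2 \<le> C * \<mu>\<^sup>2"
          using C(3) by (intro mult_right_mono) auto
        then show "norm (R 0) < 1"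
          using init_mim by (intro R_lt J'(2)) linarith
        show "norm (R u) < 1" if "u \<in> ?J" "\<And>v. v \<in> closed_segment 0 u \<Longrightarrow> norm (R v) \<le> 1" for u
          by (intro R_lt error that)
      qed
      show "?err t \<le> C * \<mu>\<^sup>2"
      proof (rule error[OF t])
        show "norm (R u) \<le> 1" if "u \<in> closed_segment 0 t" for u
          using R_bound[of u] seg[OF t] that by (blast intro: less_imp_le)
      qed
    qed
  qed
qed

end
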